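(* Let $\nabla$ be an affine connection on a smooth manifold $M$ with torsion $T^\nabla(X,Y)=\nabla_XY-\nabla_YX-[X,Y]$, and let $\mathsf{J}=\begin{pmatrix}H&\alpha\\\beta&K\end{pmatrix}$ be a weak generalized almost complex structure on $M$, with Nijenhuis tensor $N$ with respect to $[\cdot,\cdot]_\nabla$. Then $\mathsf{J}$ is $[\cdot,\cdot]_\nabla$-integrable if and only if the following conditions hold for all $X,Y\in C^\infty(TM)$ and all $\xi,\eta\in C^\infty(T^*M)$ (where $|_{TM}$, $|_{T^*M}$ denote the $TM$- and $T^*M$-components): $$\begin{aligned}N(X,Y)|_{TM}={}&(\nabla_{HX}H)Y-(\nabla_{HY}H)X-H\big((\nabla_XH)Y-(\nabla_YH)X\big)-\alpha\big((\nabla_X\beta)Y-(\nabla_Y\beta)X\big)\\&-T^\nabla(HX,HY)-T^\nabla(X,Y)+H\big(T^\nabla(HX,Y)+T^\nabla(X,HY)\big)=0,\end{aligned}$$ $$\begin{aligned}N(X,Y)|_{T^*M}={}&(\nabla_{HX}\beta)Y-(\nabla_{HY}\beta)X+\beta\big((\nabla_XH)Y-(\nabla_YH)X\big)-K\big((\nabla_X\beta)Y-(\nabla_Y\beta)X\big)\\&+\beta\big(T^\nabla(HX,Y)+T^\nabla(X,HY)\big)=0,\end{aligned}$$ $$N(\xi,\eta)|_{TM}=(\nabla_{\alpha\xi}\alpha)\eta-(\nabla_{\alpha\eta}\alpha)\xi-T^\nabla(\alpha\xi,\alpha\eta)=0,$$ $$N(\xi,\eta)|_{T^*M}=(\nabla_{\alpha\xi}K)\eta-(\nabla_{\alpha\eta}K)\xi=0,$$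 $$\begin{aligned}N(X,\eta)|_{TM}={}&(\nabla_{HX}\alpha)\eta-(\nabla_{\alpha\eta}H)X-H((\nabla_X\alpha)\eta)-\alpha((\nabla_XK)\eta)\\&-T^\nabla(HX,\alpha\eta)+H(T^\nabla(X,\alpha\eta))=0,\end{aligned}$$ $$N(X,\eta)|_{T^*M}=(\nabla_{HX}K)\eta-(\nabla_{\alpha\eta}\beta)X-\beta((\nabla_X\alpha)\eta)-K((\nabla_XK)\eta)+\beta(T^\nabla(X,\alpha\eta))=0.$$
   Context: For a smooth manifold $M$ let $E=TM\oplus T^*M$, with smooth sections $C^\infty(E)$ written $X+\xi$. A weak generalized almost complex structure is a smooth bundle endomorphism $\mathsf{J}:E\to E$ with $\mathsf{J}^2=-\mathrm{Id}$; in block form $H:TM\to TM$, $\alpha:T^*M\to TM$, $\beta:TM\to T^*M$, $K:T^*M\to T^*M$, so $\mathsf{J}(X+\xi)=(HX+\alpha\xi)+(\beta X+K\xi)$. The connection $\nabla$ is extended to $T^*M$ and to the tensors $H,\alpha,\beta,K$ in the usual way. The bracket is $[X+\xi,Y+\eta]_\nabla=[X,Y]+\nabla_X\eta-\nabla_Y\xi$, and $N(v,w)=[\mathsf{J}v,\mathsf{J}w]_\nabla-\mathsf{J}[\mathsf{J}v,w]_\nabla-\mathsf{J}[v,\mathsf{J}w]_\nabla+\mathsf{J}^2[v,w]_\nabla$ for $v,w\in C^\infty(E)$. $\mathsf{J}$ is $[\cdot,\cdot]_\nabla$-integrable if $N\equiv0$.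
   Formalization: Two printed signs are false and are corrected: in N(X,Y)|_TM the term −T^∇(X,Y) becomes +T^∇(X,Y), and in N(X,Y)|_{T*M} the term +β((∇_XH)Y−(∇_YH)X) becomes −β((∇_XH)Y−(∇_YH)X). *)

theory Defs
  imports "HOL-Analysis.Analysis" "HOL-Library.Function_Algebras"
begin

instantiation "fun" :: (type, real_vector) real_vector
begin

definition scaleR_fun :: "real \<Rightarrow> ('a \<Rightarrow> 'b) \<Rightarrow> 'a \<Rightarrow> 'b"
  where "scaleR_fun r f = (\<lambda>x. r *\<^sub>R f x)"

instance
  by standard (simp_all add: scaleR_fun_def fun_eq_iff scaleR_add_right scaleR_add_left)

end


section \<open>Smooth manifolds\<close>

text \<open>\<open>Ck_on k f S\<close> is the usual notion of a \<open>k\<close> times continuously differentiable map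
  when \<open>S\<close> is open; it is only used for open \<open>S\<close>.\<close>

primrec Ck_on :: "nat \<Rightarrow> ('b::real_normed_vector \<Rightarrow> 'c::real_normed_vector) \<Rightarrow> 'b set \<Rightarrow> bool" where
  "Ck_on 0 f S \<longleftrightarrow> continuous_on S f"
| "Ck_on (Suc k) f S \<longleftrightarrow>
     (\<forall>x\<in>S. f differentiable (at x)) \<and> (\<forall>v. Ck_on k (\<lambda>x. frechet_derivative f (at x) v) S)"

definition smooth_on :: "'b set \<Rightarrow> ('b::real_normed_vector \<Rightarrow> 'c::real_normed_vector) \<Rightarrow> bool" where
  "smooth_on S f \<longleftrightarrow> (\<forall>k. Ck_on k f S)"

type_synonym ('a, 'b) chart = "'a set \<times> ('a \<Rightarrow> 'b)"

abbreviation dom_chart :: "('a, 'b) chart \<Rightarrow> 'a set" where "dom_chart c \<equiv> fst c"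
abbreviation coord :: "('a, 'b) chart \<Rightarrow> 'a \<Rightarrow> 'b" where "coord c \<equiv> snd c"

definition cod_chart :: "('a, 'b) chart \<Rightarrow> 'b set" where
  "cod_chart c = coord c ` dom_chart c"

definition inv_chart :: "('a, 'b) chart \<Rightarrow> 'b \<Rightarrow> 'a" where
  "inv_chart c = inv_into (dom_chart c) (coord c)"

definition is_chart :: "('a::topological_space, 'b::euclidean_space) chart \<Rightarrow> bool" where
  "is_chart c \<longleftrightarrow> open (dom_chart c) \<and> open (cod_chart c) \<and>
     homeomorphism (dom_chart c) (cod_chart c) (coord c) (inv_chart c)"

text \<open>A smooth manifold is a type of class \<open>t2_space\<close> and \<open>second_countable_topology\<close>
  together with a (not necessarily maximal) smooth atlas.\<close>

definition smooth_atlas ::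
  "('a::{t2_space, second_countable_topology}, 'b::euclidean_space) chart set \<Rightarrow> bool" where
  "smooth_atlas \<A> \<longleftrightarrow> (\<forall>c\<in>\<A>. is_chart c) \<and> (\<Union>c\<in>\<A>. dom_chart c) = UNIV \<and>
     (\<forall>c\<in>\<A>. \<forall>d\<in>\<A>.
        smooth_on (coord c ` (dom_chart c \<inter> dom_chart d)) (coord d \<circ> inv_chart c))"

definition smooth_functions ::
  "('a::topological_space, 'b::euclidean_space) chart set \<Rightarrow> ('a \<Rightarrow> real) set" where
  "smooth_functions \<A> = {f. \<forall>c\<in>\<A>. smooth_on (cod_chart c) (f \<circ> inv_chart c)}"


section \<open>Tangent and cotangent bundle\<close>

text \<open>A tangent vector at \<open>p\<close> is the family of its coordinate vectors in all the charts of the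
  atlas around \<open>p\<close>, related by the derivatives of the coordinate changes.  It is extended by \<open>0\<close>
  to all other charts, so that the pointwise operations on functions are the vector space
  operations of the tangent space.  Likewise a cotangent vector is a linear functional on the
  tangent space, extended by \<open>0\<close>.\<close>

type_synonym ('a, 'b) tvec = "('a, 'b) chart \<Rightarrow> 'b"
type_synonym ('a, 'b) covec = "('a, 'b) tvec \<Rightarrow> real"
type_synonym ('a, 'b) gvec = "('a, 'b) tvec \<times> ('a, 'b) covec"

type_synonym ('a, 'b) vfield = "'a \<Rightarrow> ('a, 'b) tvec"
type_synonym ('a, 'b) oneform = "'a \<Rightarrow> ('a, 'b) covec"
type_synonym ('a, 'b) gsection = "'a \<Rightarrow> ('a, 'b) gvec"
type_synonym ('a, 'b) gendo = "'a \<Rightarrow> ('a, 'b) gvec \<Rightarrow> ('a, 'b) gvec"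

definition transition_deriv :: "('a, 'b::euclidean_space) chart \<Rightarrow> ('a, 'b) chart \<Rightarrow> 'a \<Rightarrow> 'b \<Rightarrow> 'b" where
  "transition_deriv c d p = frechet_derivative (coord d \<circ> inv_chart c) (at (coord c p))"

definition tangent_space ::
  "('a, 'b::euclidean_space) chart set \<Rightarrow> 'a \<Rightarrow> ('a, 'b) tvec set" where
  "tangent_space \<A> p = {v.
     (\<forall>c. \<not> (c \<in> \<A> \<and> p \<in> dom_chart c) \<longrightarrow> v c = 0) \<and>
     (\<forall>c\<in>\<A>. \<forall>d\<in>\<A>. p \<in> dom_chart c \<inter> dom_chart d \<longrightarrow> v d = transition_deriv c d p (v c))}"

definition cotangent_space ::
  "('a, 'b::euclidean_space) chart set \<Rightarrow> 'a \<Rightarrow> ('a, 'b) covec set" where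
  "cotangent_space \<A> p = {\<omega>.
     (\<forall>v. v \<notin> tangent_space \<A> p \<longrightarrow> \<omega> v = 0) \<and>
     (\<forall>v\<in>tangent_space \<A> p. \<forall>w\<in>tangent_space \<A> p. \<omega> (v + w) = \<omega> v + \<omega> w) \<and>
     (\<forall>r. \<forall>v\<in>tangent_space \<A> p. \<omega> (r *\<^sub>R v) = r * \<omega> v)}"

definition gen_tangent_space ::
  "('a, 'b::euclidean_space) chart set \<Rightarrow> 'a \<Rightarrow> ('a, 'b) gvec set" where
  "gen_tangent_space \<A> p = tangent_space \<A> p \<times> cotangent_space \<A> p"

text \<open>For \<open>e\<close> in the standard basis, these are the coordinate fields \<open>\<partial>/\<partial>x\<^sup>e\<close> and \<open>dx\<^sup>e\<close> of the
  chart \<open>c\<close>.\<close>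

definition coord_vector ::
  "('a, 'b::euclidean_space) chart set \<Rightarrow> ('a, 'b) chart \<Rightarrow> 'b \<Rightarrow> ('a, 'b) vfield" where
  "coord_vector \<A> c e p =
     (\<lambda>d. if d \<in> \<A> \<and> p \<in> dom_chart d then transition_deriv c d p e else 0)"

definition coord_covector ::
  "('a, 'b::euclidean_space) chart set \<Rightarrow> ('a, 'b) chart \<Rightarrow> 'b \<Rightarrow> ('a, 'b) oneform" where
  "coord_covector \<A> c e p = (\<lambda>v. if v \<in> tangent_space \<A> p then v c \<bullet> e else 0)"

text \<open>Smoothness of a field on the domain of a chart means smoothness of its components with
  respect to the coordinate frame.\<close>

definition vector_smooth_in ::
  "('a, 'b::euclidean_space) chart \<Rightarrow> ('a, 'b) vfield \<Rightarrow> bool" where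
  "vector_smooth_in c X \<longleftrightarrow> smooth_on (cod_chart c) (\<lambda>x. X (inv_chart c x) c)"

definition covector_smooth_in ::
  "('a, 'b::euclidean_space) chart set \<Rightarrow> ('a, 'b) chart \<Rightarrow> ('a, 'b) oneform \<Rightarrow> bool" where
  "covector_smooth_in \<A> c \<xi> \<longleftrightarrow>
     (\<forall>e\<in>Basis. smooth_on (cod_chart c)
        (\<lambda>x. \<xi> (inv_chart c x) (coord_vector \<A> c e (inv_chart c x))))"

definition vector_fields ::
  "('a, 'b::euclidean_space) chart set \<Rightarrow> ('a, 'b) vfield set" where
  "vector_fields \<A> = {X. (\<forall>p. X p \<in> tangent_space \<A> p) \<and> (\<forall>c\<in>\<A>. vector_smooth_in c X)}"

definition one_forms ::
  "('a, 'b::euclidean_space) chart set \<Rightarrow> ('a, 'b) oneform set" where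
  "one_forms \<A> = {\<xi>. (\<forall>p. \<xi> p \<in> cotangent_space \<A> p) \<and> (\<forall>c\<in>\<A>. covector_smooth_in \<A> c \<xi>)}"

definition TM_part :: "('a, 'b) gsection \<Rightarrow> ('a, 'b) vfield" where
  "TM_part s = (\<lambda>p. fst (s p))"

definition TsM_part :: "('a, 'b) gsection \<Rightarrow> ('a, 'b) oneform" where
  "TsM_part s = (\<lambda>p. snd (s p))"

definition of_TM :: "('a, 'b) vfield \<Rightarrow> ('a, 'b) gsection" where
  "of_TM X = (\<lambda>p. (X p, 0))"

definition of_TsM :: "('a, 'b::zero) oneform \<Rightarrow> ('a, 'b) gsection" where
  "of_TsM \<xi> = (\<lambda>p. (0, \<xi> p))"

definition gen_sections ::
  "('a, 'b::euclidean_space) chart set \<Rightarrow> ('a, 'b) gsection set" where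
  "gen_sections \<A> = {s. TM_part s \<in> vector_fields \<A> \<and> TsM_part s \<in> one_forms \<A>}"


section \<open>Generalized almost complex structures\<close>

definition act :: "('a \<Rightarrow> 'u \<Rightarrow> 'v) \<Rightarrow> ('a \<Rightarrow> 'u) \<Rightarrow> 'a \<Rightarrow> 'v" (infixr "\<cdot>" 85) where
  "A \<cdot> s = (\<lambda>p. A p (s p))"

text \<open>Smoothness of the bundle map is smoothness of its matrix with respect to the frame of
  \<open>TM \<oplus> T\<^sup>*M\<close> formed by the coordinate fields of any chart.\<close>

definition smooth_bundle_endo ::
  "('a, 'b::euclidean_space) chart set \<Rightarrow> ('a, 'b) gendo \<Rightarrow> bool" where
  "smooth_bundle_endo \<A> J \<longleftrightarrow>
     (\<forall>p. \<forall>u\<in>gen_tangent_space \<A> p. J p u \<in> gen_tangent_space \<A> p) \<and>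
     (\<forall>p. \<forall>u\<in>gen_tangent_space \<A> p. \<forall>w\<in>gen_tangent_space \<A> p. J p (u + w) = J p u + J p w) \<and>
     (\<forall>p r. \<forall>u\<in>gen_tangent_space \<A> p. J p (r *\<^sub>R u) = r *\<^sub>R J p u) \<and>
     (\<forall>c\<in>\<A>. \<forall>e\<in>Basis. \<forall>s\<in>{of_TM (coord_vector \<A> c e), of_TsM (coord_covector \<A> c e)}.
        vector_smooth_in c (TM_part (J \<cdot> s)) \<and> covector_smooth_in \<A> c (TsM_part (J \<cdot> s)))"

definition weak_gen_almost_complex ::
  "('a, 'b::euclidean_space) chart set \<Rightarrow> ('a, 'b) gendo \<Rightarrow> bool" where
  "weak_gen_almost_complex \<A> J \<longleftrightarrow> smooth_bundle_endo \<A> J \<and>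
     (\<forall>p. \<forall>u\<in>gen_tangent_space \<A> p. J p (J p u) = - u)"

definition block_H :: "('a, 'b) gendo \<Rightarrow> 'a \<Rightarrow> ('a, 'b) tvec \<Rightarrow> ('a, 'b) tvec" where
  "block_H J p v = fst (J p (v, 0))"

definition block_alpha ::
  "('a, 'b::zero) gendo \<Rightarrow> 'a \<Rightarrow> ('a, 'b) covec \<Rightarrow> ('a, 'b) tvec" where
  "block_alpha J p \<omega> = fst (J p (0, \<omega>))"

definition block_beta :: "('a, 'b) gendo \<Rightarrow> 'a \<Rightarrow> ('a, 'b) tvec \<Rightarrow> ('a, 'b) covec" where
  "block_beta J p v = snd (J p (v, 0))"

definition block_K ::
  "('a, 'b::zero) gendo \<Rightarrow> 'a \<Rightarrow> ('a, 'b) covec \<Rightarrow> ('a, 'b) covec" where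
  "block_K J p \<omega> = snd (J p (0, \<omega>))"


section \<open>Lie bracket and affine connections\<close>

text \<open>The derivative of the function \<open>f\<close> along \<open>X\<close>.  By the chain rule it does not depend on the
  choice of the chart \<open>c\<close> around \<open>p\<close>.\<close>

definition lie_derivative ::
  "('a, 'b::euclidean_space) chart set \<Rightarrow> ('a, 'b) vfield \<Rightarrow> ('a \<Rightarrow> real) \<Rightarrow> 'a \<Rightarrow> real" where
  "lie_derivative \<A> X f p =
     (let c = (SOME c. c \<in> \<A> \<and> p \<in> dom_chart c)
      in frechet_derivative (f \<circ> inv_chart c) (at (coord c p)) (X p c))"

text \<open>In the coordinates of each chart, \<open>[X, Y]\<close> is \<open>DY(X) - DX(Y)\<close>.\<close>

definition lie_bracket ::
  "('a, 'b::euclidean_space) chart set \<Rightarrow> ('a, 'b) vfield \<Rightarrow> ('a, 'b) vfield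
     \<Rightarrow> ('a, 'b) vfield" where
  "lie_bracket \<A> X Y p = (\<lambda>c. if c \<in> \<A> \<and> p \<in> dom_chart c
     then frechet_derivative (\<lambda>x. Y (inv_chart c x) c) (at (coord c p)) (X p c)
        - frechet_derivative (\<lambda>x. X (inv_chart c x) c) (at (coord c p)) (Y p c)
     else 0)"

definition affine_connection ::
  "('a::topological_space, 'b::euclidean_space) chart set
     \<Rightarrow> (('a, 'b) vfield \<Rightarrow> ('a, 'b) vfield \<Rightarrow> ('a, 'b) vfield) \<Rightarrow> bool" where
  "affine_connection \<A> D \<longleftrightarrow>
     (\<forall>X\<in>vector_fields \<A>. \<forall>Y\<in>vector_fields \<A>. D X Y \<in> vector_fields \<A>) \<and>
     (\<forall>X\<in>vector_fields \<A>. \<forall>X'\<in>vector_fields \<A>. \<forall>Y\<in>vector_fields \<A>.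
        D (X + X') Y = D X Y + D X' Y) \<and>
     (\<forall>f\<in>smooth_functions \<A>. \<forall>X\<in>vector_fields \<A>. \<forall>Y\<in>vector_fields \<A>.
        D (\<lambda>p. f p *\<^sub>R X p) Y = (\<lambda>p. f p *\<^sub>R D X Y p)) \<and>
     (\<forall>X\<in>vector_fields \<A>. \<forall>Y\<in>vector_fields \<A>. \<forall>Y'\<in>vector_fields \<A>.
        D X (Y + Y') = D X Y + D X Y') \<and>
     (\<forall>f\<in>smooth_functions \<A>. \<forall>X\<in>vector_fields \<A>. \<forall>Y\<in>vector_fields \<A>.
        D X (\<lambda>p. f p *\<^sub>R Y p) = (\<lambda>p. lie_derivative \<A> X f p *\<^sub>R Y p + f p *\<^sub>R D X Y p))"

definition torsion ::
  "('a, 'b::euclidean_space) chart set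
     \<Rightarrow> (('a, 'b) vfield \<Rightarrow> ('a, 'b) vfield \<Rightarrow> ('a, 'b) vfield)
     \<Rightarrow> ('a, 'b) vfield \<Rightarrow> ('a, 'b) vfield \<Rightarrow> ('a, 'b) vfield" where
  "torsion \<A> D X Y = D X Y - D Y X - lie_bracket \<A> X Y"

text \<open>The induced connection on one-forms: \<open>(\<nabla>\<^sub>X \<xi>)(Y) = X(\<xi>(Y)) - \<xi>(\<nabla>\<^sub>X Y)\<close>.\<close>

definition dual_connection ::
  "('a, 'b::euclidean_space) chart set
     \<Rightarrow> (('a, 'b) vfield \<Rightarrow> ('a, 'b) vfield \<Rightarrow> ('a, 'b) vfield)
     \<Rightarrow> ('a, 'b) vfield \<Rightarrow> ('a, 'b) oneform \<Rightarrow> ('a, 'b) oneform" where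
  "dual_connection \<A> D X \<xi> = (THE \<omega>. \<omega> \<in> one_forms \<A> \<and>
     (\<forall>Y\<in>vector_fields \<A>. \<omega> \<cdot> Y = lie_derivative \<A> X (\<xi> \<cdot> Y) - \<xi> \<cdot> D X Y))"

text \<open>The covariant derivative of a bundle map \<open>A\<close>, given the covariant derivatives \<open>D\<close> and \<open>D'\<close>
  of the sections of its source and of its target: \<open>(\<nabla>\<^sub>X A) s = \<nabla>\<^sub>X (A s) - A (\<nabla>\<^sub>X s)\<close>.\<close>

definition hom_derivative ::
  "('x \<Rightarrow> ('a \<Rightarrow> 'u) \<Rightarrow> 'a \<Rightarrow> 'u) \<Rightarrow> ('x \<Rightarrow> ('a \<Rightarrow> 'v) \<Rightarrow> 'a \<Rightarrow> 'v::minus)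
     \<Rightarrow> ('a \<Rightarrow> 'u \<Rightarrow> 'v) \<Rightarrow> 'x \<Rightarrow> ('a \<Rightarrow> 'u) \<Rightarrow> 'a \<Rightarrow> 'v" where
  "hom_derivative D D' A X s = D' X (A \<cdot> s) - A \<cdot> D X s"


section \<open>Integrability\<close>

definition nabla_bracket ::
  "('a, 'b::euclidean_space) chart set
     \<Rightarrow> (('a, 'b) vfield \<Rightarrow> ('a, 'b) vfield \<Rightarrow> ('a, 'b) vfield)
     \<Rightarrow> ('a, 'b) gsection \<Rightarrow> ('a, 'b) gsection \<Rightarrow> ('a, 'b) gsection" where
  "nabla_bracket \<A> D v w =
     of_TM (lie_bracket \<A> (TM_part v) (TM_part w)) +
     of_TsM (dual_connection \<A> D (TM_part v) (TsM_part w)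
             - dual_connection \<A> D (TM_part w) (TsM_part v))"

definition nijenhuis ::
  "('a, 'b::euclidean_space) chart set
     \<Rightarrow> (('a, 'b) vfield \<Rightarrow> ('a, 'b) vfield \<Rightarrow> ('a, 'b) vfield)
     \<Rightarrow> ('a, 'b) gendo
     \<Rightarrow> ('a, 'b) gsection \<Rightarrow> ('a, 'b) gsection \<Rightarrow> ('a, 'b) gsection" where
  "nijenhuis \<A> D J v w =
     nabla_bracket \<A> D (J \<cdot> v) (J \<cdot> w) - J \<cdot> nabla_bracket \<A> D (J \<cdot> v) w
     - J \<cdot> nabla_bracket \<A> D v (J \<cdot> w) + J \<cdot> J \<cdot> nabla_bracket \<A> D v w"

definition nabla_integrable ::
  "('a, 'b::euclidean_space) chart set
     \<Rightarrow> (('a, 'b) vfield \<Rightarrow> ('a, 'b) vfield \<Rightarrow> ('a, 'b) vfield)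
     \<Rightarrow> ('a, 'b) gendo \<Rightarrow> bool" where
  "nabla_integrable \<A> D J \<longleftrightarrow>
     (\<forall>v\<in>gen_sections \<A>. \<forall>w\<in>gen_sections \<A>. nijenhuis \<A> D J v w = 0)"

end

theory Submission
  imports Defs
begin

text \<open>The block form of \<open>J\<^sup>2 = -1\<close> and \<open>[X, Y] = \<nabla>\<^sub>X Y - \<nabla>\<^sub>Y X - T(X, Y)\<close> turn each component of the
  Nijenhuis tensor into the stated expression, pointwise and by linearity of \<open>J\<close> on the fibres.
  Integrability then reduces to the three kinds of arguments because \<open>N\<close> is biadditive and
  skew-symmetric.  Since \<open>J\<close> is only linear on the generalized tangent spaces, this needs that
  everything stays in them: for the Lie bracket this is the symmetry of the second derivatives of
  the coordinate changes, and for the dual connection it is the existence of bump functions, by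
  which a \<open>C\<^sup>\<infinity>\<close>-linear functional on vector fields is a one-form.\<close>

section \<open>Calculus of smooth maps\<close>

text \<open>Two definitions carry obligations that their formulas do not show.
  \<open>lie_bracket\<close> is a coordinate expression in each chart separately, so it is a theorem
  that its components transform like those of a tangent vector. \<open>dual_connection\<close> is a
  definite description, so nothing can be said about it until a one-form with the prescribed
  pairings is known to exist and to be unique. Existence is a problem of localisation. Coordinate
  fields live on one chart, whereas the connection and the pairings act on global fields only, so a
  local expansion must be multiplied by a bump function before anything can be applied to it. The
  same device lets smoothness of a one-form be tested by its pairings with global fields. On the
  analytic side, \<open>Ck_on\<close> controls derivatives in fixed directions only. Derivatives in
  a direction that depends on the point, which occur in the chain rule and in the bracket, are
  therefore expanded in the standard basis. Once all memberships are available, the formulas for the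
  components of \<open>N\<close> are mere rewriting.\<close>

lemma has_frechet_derivative:
  assumes "f differentiable (at x)"
  shows "(f has_derivative frechet_derivative f (at x)) (at x)"
  using assms by (simp add: frechet_derivative_works)

text \<open>\<open>frechet_derivative\<close> is a Hilbert choice among the maps satisfying
  \<open>has_derivative\<close>. Near \<open>x\<close> the two functions agree, so both choices are
  made from the same predicate; the equality thus holds even where no derivative exists.\<close>

lemma frechet_derivative_cong_open:
  assumes "open S" "x \<in> S" "\<And>y. y \<in> S \<Longrightarrow> f y = g y"
  shows "frechet_derivative f (at x) = frechet_derivative g (at x)"
proof -
  have "(f has_derivative F) (at x) \<longleftrightarrow> (g has_derivative F) (at x)" for F
    using assms has_derivative_transform_within_open[of f F x UNIV S g]
      has_derivative_transform_within_open[of g F x UNIV S f] by auto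
  then show ?thesis by (simp add: frechet_derivative_def)
qed

lemma differentiable_cong_open:
  assumes "f differentiable (at x)" "open S" "x \<in> S" "\<And>y. y \<in> S \<Longrightarrow> f y = g y"
  shows "g differentiable (at x)"
  using assms unfolding differentiable_def
  by (metis has_derivative_transform_within_open)

lemma Ck_on_cong:
  assumes "open S" "\<And>x. x \<in> S \<Longrightarrow> f x = g x" "Ck_on k f S"
  shows "Ck_on k g S"
  using assms
proof (induction k arbitrary: f g)
  case 0
  then show ?case by (simp cong: continuous_on_cong)
next
  case (Suc k)
  have "Ck_on k (\<lambda>x. frechet_derivative g (at x) v) S" for v
  proof (rule Suc.IH[of "\<lambda>x. frechet_derivative f (at x) v"])
    show "frechet_derivative f (at x) v = frechet_derivative g (at x) v" if "x \<in> S" for x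
      by (simp add: frechet_derivative_cong_open[OF Suc.prems(1) that Suc.prems(2)])
  qed (use Suc.prems in auto)
  moreover have "g differentiable (at x)" if "x \<in> S" for x
    using Suc.prems that by (auto intro: differentiable_cong_open)
  ultimately show ?case by simp
qed

lemma Ck_on_SucD: "Ck_on (Suc k) f S \<Longrightarrow> Ck_on k f S"
proof (induction k arbitrary: f)
  case 0
  then show ?case
    by (auto intro!: continuous_at_imp_continuous_on differentiable_imp_continuous_within)
next
  case (Suc k)
  then show ?case by (metis Ck_on.simps(2))
qed

lemma Ck_on_imp_continuous_on: "Ck_on k f S \<Longrightarrow> continuous_on S f"
  by (induction k) (use Ck_on_SucD in \<open>force+\<close>)

text \<open>Continuity, differentiability and the value of \<open>frechet_derivative\<close> at a
  point depend only on a neighbourhood, so every clause of \<open>Ck_on\<close> can be checked on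
  the local \<open>U\<close>.\<close>

lemma Ck_on_local:
  assumes "\<And>x. x \<in> S \<Longrightarrow> \<exists>U. open U \<and> x \<in> U \<and> Ck_on k f U"
  shows "Ck_on k f S"
  using assms
proof (induction k arbitrary: f)
  case 0
  show ?case
  proof (simp, rule continuous_at_imp_continuous_on, rule ballI)
    fix x assume "x \<in> S"
    then obtain U where "open U" "x \<in> U" "continuous_on U f" using 0 by force
    then show "isCont f x" by (simp add: continuous_on_eq_continuous_at)
  qed
next
  case (Suc k)
  have "f differentiable (at x)" if "x \<in> S" for x
    using Suc.prems[OF that] by auto
  moreover have "Ck_on k (\<lambda>x. frechet_derivative f (at x) v) S" for v
    using Suc.prems by (intro Suc.IH) force
  ultimately show ?case by simp
qed

lemma Ck_on_subset: "Ck_on k f S \<Longrightarrow> T \<subseteq> S \<Longrightarrow> Ck_on k f T"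
  by (induction k arbitrary: f) (auto intro: continuous_on_subset)

lemma Ck_on_const: "Ck_on k (\<lambda>x. c) S"
  by (induction k arbitrary: c) auto

text \<open>Replaces the chosen derivative by any explicit family \<open>F\<close>. The closure
  rules for sums, products, inverses and composites all use it: a formula for the derivative, to
  which the induction hypothesis applies.\<close>

lemma Ck_on_SucI:
  assumes "open S" "\<And>x. x \<in> S \<Longrightarrow> (f has_derivative F x) (at x)"
    "\<And>v. Ck_on k (\<lambda>x. F x v) S"
  shows "Ck_on (Suc k) f S"
proof -
  have "F x = frechet_derivative f (at x)" if "x \<in> S" for x
    using assms(2)[OF that] by (rule frechet_derivative_at)
  then have "Ck_on k (\<lambda>x. frechet_derivative f (at x) v) S" for v
    by (intro Ck_on_cong[OF assms(1) _ assms(3)[of v]]) simp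
  then show ?thesis using assms(2) by (auto simp: differentiable_def)
qed

lemma Ck_on_Suc_has_derivative:
  "Ck_on (Suc k) f S \<Longrightarrow> x \<in> S \<Longrightarrow> (f has_derivative frechet_derivative f (at x)) (at x)"
  by (simp add: has_frechet_derivative)

lemma Ck_on_Suc_derivative:
  "Ck_on (Suc k) f S \<Longrightarrow> Ck_on k (\<lambda>x. frechet_derivative f (at x) v) S"
  by simp

lemma Ck_on_add:
  assumes "open S" "Ck_on k f S" "Ck_on k g S"
  shows "Ck_on k (\<lambda>x. f x + g x) S"
  using assms
proof (induction k arbitrary: f g)
  case 0
  then show ?case by (auto intro: continuous_on_add)
next
  case (Suc k)
  define F where "F x = frechet_derivative f (at x)" for x
  have F: "\<And>x. x \<in> S \<Longrightarrow> (f has_derivative F x) (at x)" "\<And>v. Ck_on k (\<lambda>x. F x v) S"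
    unfolding F_def by (fact Ck_on_Suc_has_derivative[OF Suc.prems(2)] Ck_on_Suc_derivative[OF Suc.prems(2)])+
  define G where "G x = frechet_derivative g (at x)" for x
  have G: "\<And>x. x \<in> S \<Longrightarrow> (g has_derivative G x) (at x)" "\<And>v. Ck_on k (\<lambda>x. G x v) S"
    unfolding G_def by (fact Ck_on_Suc_has_derivative[OF Suc.prems(3)] Ck_on_Suc_derivative[OF Suc.prems(3)])+
  show ?case
    by (rule Ck_on_SucI[where F = "\<lambda>x v. F x v + G x v"])
      (use Suc F G in \<open>auto intro: has_derivative_add\<close>)
qed

lemma Ck_on_bounded_linear:
  assumes "open S" "bounded_linear L" "Ck_on k f S"
  shows "Ck_on k (\<lambda>x. L (f x)) S"
  using assms
proof (induction k arbitrary: f)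
  case 0
  then show ?case by (auto intro: bounded_linear.continuous_on)
next
  case (Suc k)
  define F where "F x = frechet_derivative f (at x)" for x
  have F: "\<And>x. x \<in> S \<Longrightarrow> (f has_derivative F x) (at x)" "\<And>v. Ck_on k (\<lambda>x. F x v) S"
    unfolding F_def by (fact Ck_on_Suc_has_derivative[OF Suc.prems(3)] Ck_on_Suc_derivative[OF Suc.prems(3)])+
  show ?case
    by (rule Ck_on_SucI[where F = "\<lambda>x v. L (F x v)"])
      (use Suc F in \<open>auto intro: bounded_linear.has_derivative\<close>)
qed

lemma Ck_on_scaleR:
  assumes "open S" "Ck_on k f S" "Ck_on k g S"
  shows "Ck_on k (\<lambda>x. f x *\<^sub>R g x) S"
  using assms
proof (induction k arbitrary: f g)
  case 0
  then show ?case by (auto intro: continuous_on_scaleR)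
next
  case (Suc k)
  define F where "F x = frechet_derivative f (at x)" for x
  have F: "\<And>x. x \<in> S \<Longrightarrow> (f has_derivative F x) (at x)" "\<And>v. Ck_on k (\<lambda>x. F x v) S"
    unfolding F_def by (fact Ck_on_Suc_has_derivative[OF Suc.prems(2)] Ck_on_Suc_derivative[OF Suc.prems(2)])+
  define G where "G x = frechet_derivative g (at x)" for x
  have G: "\<And>x. x \<in> S \<Longrightarrow> (g has_derivative G x) (at x)" "\<And>v. Ck_on k (\<lambda>x. G x v) S"
    unfolding G_def by (fact Ck_on_Suc_has_derivative[OF Suc.prems(3)] Ck_on_Suc_derivative[OF Suc.prems(3)])+
  \<comment> \<open>The product rule leaves one factor undifferentiated, so \<open>f\<close> and
    \<open>g\<close> themselves are needed at the lower order as well.\<close>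
  note D = Suc.prems(2,3)[THEN Ck_on_SucD]
  show ?case
    by (rule Ck_on_SucI[where F = "\<lambda>x v. f x *\<^sub>R G x v + F x v *\<^sub>R g x"])
      (use Suc.prems(1) Suc.IH F G D in \<open>auto intro!: has_derivative_scaleR Ck_on_add\<close>)
qed

text \<open>The derivative -(1/f) F (1/f) contains 1/f again, but only at the lower order, which is
  the induction hypothesis.\<close>

lemma Ck_on_inverse:
  fixes f :: "'b::real_normed_vector \<Rightarrow> real"
  assumes "open S" "Ck_on k f S" "\<And>x. x \<in> S \<Longrightarrow> f x \<noteq> 0"
  shows "Ck_on k (\<lambda>x. inverse (f x)) S"
  using assms
proof (induction k)
  case 0
  then show ?case by (auto intro: continuous_on_inverse)
next
  case (Suc k)
  define F where "F x = frechet_derivative f (at x)" for x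
  have F: "\<And>x. x \<in> S \<Longrightarrow> (f has_derivative F x) (at x)" "\<And>v. Ck_on k (\<lambda>x. F x v) S"
    unfolding F_def by (fact Ck_on_Suc_has_derivative[OF Suc.prems(2)] Ck_on_Suc_derivative[OF Suc.prems(2)])+
  have I: "Ck_on k (\<lambda>x. inverse (f x)) S"
    by (rule Suc.IH[OF Suc.prems(1) Ck_on_SucD[OF Suc.prems(2)] Suc.prems(3)])
  \<comment> \<open>Written with \<open>*\<^sub>R\<close> throughout, so that
    \<open>Ck_on_scaleR\<close> covers every product and also the sign.\<close>
  have "Ck_on k (\<lambda>x. (-1) *\<^sub>R (inverse (f x) *\<^sub>R F x v *\<^sub>R inverse (f x))) S" for v
    by (intro Ck_on_scaleR Ck_on_const I F Suc.prems)
  then have "Ck_on k (\<lambda>x. - (inverse (f x) * F x v * inverse (f x))) S" for v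
    by (simp add: mult.assoc)
  moreover have "((\<lambda>x. inverse (f x)) has_derivative (\<lambda>v. - (inverse (f x) * F x v * inverse (f x)))) (at x)"
    if "x \<in> S" for x
    by (rule Deriv.has_derivative_inverse[OF Suc.prems(3)[OF that] F(1)[OF that]])
  ultimately show ?case by (intro Ck_on_SucI[OF Suc.prems(1)])
qed

lemma Ck_on_sum:
  assumes "open S" "\<And>i. i \<in> I \<Longrightarrow> Ck_on k (f i) S"
  shows "Ck_on k (\<lambda>x. \<Sum>i\<in>I. f i x) S"
  using assms(2)
  by (induction I rule: infinite_finite_induct) (auto intro: Ck_on_const Ck_on_add assms(1))

lemma linear_basis_expand:
  fixes F :: "'b::euclidean_space \<Rightarrow> 'c::real_vector"
  assumes "linear F"
  shows "F v = (\<Sum>e\<in>Basis. (v \<bullet> e) *\<^sub>R F e)"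
proof -
  have "F v = F (\<Sum>e\<in>Basis. (v \<bullet> e) *\<^sub>R e)" by (simp add: euclidean_representation)
  also have "\<dots> = (\<Sum>e\<in>Basis. (v \<bullet> e) *\<^sub>R F e)"
    using assms by (simp add: linear_sum linear_cmul)
  finally show ?thesis .
qed

text \<open>The chain rule gives \<open>G (f x) (F x v)\<close>, where both the base point and the
  direction move. Expanding the direction in the basis leaves coefficients from \<open>F\<close> and
  the composites of \<open>f\<close> with the maps \<open>G _ e\<close>. These are composites of the
  original kind at lower order, with another outer map, whence the induction for arbitrary
  \<open>g\<close>.\<close>

lemma Ck_on_compose:
  fixes f :: "'a::real_normed_vector \<Rightarrow> 'b::euclidean_space" and g :: "'b \<Rightarrow> 'c::real_normed_vector"
  assumes "open S" "open T" "f ` S \<subseteq> T" "Ck_on k f S" "Ck_on k g T"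
  shows "Ck_on k (\<lambda>x. g (f x)) S"
  using assms
proof (induction k arbitrary: g)
  case 0
  then show ?case by (auto intro: continuous_on_compose2)
next
  case (Suc k)
  define F where "F x = frechet_derivative f (at x)" for x
  have F: "\<And>x. x \<in> S \<Longrightarrow> (f has_derivative F x) (at x)" "\<And>v. Ck_on k (\<lambda>x. F x v) S"
    unfolding F_def by (fact Ck_on_Suc_has_derivative[OF Suc.prems(4)] Ck_on_Suc_derivative[OF Suc.prems(4)])+
  define G where "G x = frechet_derivative g (at x)" for x
  have G: "\<And>x. x \<in> T \<Longrightarrow> (g has_derivative G x) (at x)" "\<And>v. Ck_on k (\<lambda>x. G x v) T"
    unfolding G_def by (fact Ck_on_Suc_has_derivative[OF Suc.prems(5)] Ck_on_Suc_derivative[OF Suc.prems(5)])+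
  have der: "((\<lambda>x. g (f x)) has_derivative (\<lambda>v. G (f x) (F x v))) (at x)" if "x \<in> S" for x
    using Suc.prems that by (intro has_derivative_compose[of f, OF F(1) G(1)]) auto
  have "Ck_on k (\<lambda>x. \<Sum>e\<in>Basis. (F x v \<bullet> e) *\<^sub>R G (f x) e) S" for v
    by (intro Ck_on_sum Ck_on_scaleR Ck_on_bounded_linear[OF _ bounded_linear_inner_left]
        Suc.IH[OF Suc.prems(1,2,3) Ck_on_SucD[OF Suc.prems(4)] G(2)] F(2) Suc.prems(1))
  moreover have "(\<Sum>e\<in>Basis. (F x v \<bullet> e) *\<^sub>R G (f x) e) = G (f x) (F x v)" if "x \<in> S" for x v
    using that Suc.prems(3)
    by (intro linear_basis_expand[symmetric] has_derivative_linear[OF G(1)]) auto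
  ultimately have "Ck_on k (\<lambda>x. G (f x) (F x v)) S" for v
    by (rule Ck_on_cong[OF Suc.prems(1), rotated])
  from Suc.prems(1) der this show ?case
    by (rule Ck_on_SucI[where F = "\<lambda>x v. G (f x) (F x v)"])
qed

lemma Ck_on_ident: "open S \<Longrightarrow> Ck_on k (\<lambda>x. x) S"
  by (cases k) (auto intro!: Ck_on_SucI[where F = "\<lambda>x v. v"] Ck_on_const has_derivative_ident)

section \<open>Closure properties of smooth maps\<close>

lemma smooth_on_cong:
  "open S \<Longrightarrow> (\<And>x. x \<in> S \<Longrightarrow> f x = g x) \<Longrightarrow> smooth_on S f \<Longrightarrow> smooth_on S g"
  unfolding smooth_on_def using Ck_on_cong by metis

lemma smooth_on_subset: "smooth_on S f \<Longrightarrow> T \<subseteq> S \<Longrightarrow> smooth_on T f"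
  unfolding smooth_on_def using Ck_on_subset by blast

lemma smooth_on_local:
  assumes "\<And>x. x \<in> S \<Longrightarrow> \<exists>U. open U \<and> x \<in> U \<and> smooth_on U f"
  shows "smooth_on S f"
  using assms unfolding smooth_on_def by (meson Ck_on_local)

lemma smooth_on_const: "smooth_on S (\<lambda>x. c)"
  unfolding smooth_on_def by (simp add: Ck_on_const)

lemma smooth_on_ident: "open S \<Longrightarrow> smooth_on S (\<lambda>x. x)"
  unfolding smooth_on_def by (simp add: Ck_on_ident)

lemma smooth_on_add:
  "open S \<Longrightarrow> smooth_on S f \<Longrightarrow> smooth_on S g \<Longrightarrow> smooth_on S (\<lambda>x. f x + g x)"
  unfolding smooth_on_def by (simp add: Ck_on_add)

lemma smooth_on_scaleR:
  "open S \<Longrightarrow> smooth_on S f \<Longrightarrow> smooth_on S g \<Longrightarrow> smooth_on S (\<lambda>x. f x *\<^sub>R g x)"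
  unfolding smooth_on_def by (simp add: Ck_on_scaleR)

lemma smooth_on_mult:
  fixes f :: "'b::real_normed_vector \<Rightarrow> real"
  shows "open S \<Longrightarrow> smooth_on S f \<Longrightarrow> smooth_on S g \<Longrightarrow> smooth_on S (\<lambda>x. f x * g x)"
  using smooth_on_scaleR[of S f g] by simp

lemma smooth_on_bounded_linear:
  "open S \<Longrightarrow> bounded_linear L \<Longrightarrow> smooth_on S f \<Longrightarrow> smooth_on S (\<lambda>x. L (f x))"
  unfolding smooth_on_def by (simp add: Ck_on_bounded_linear)

lemma smooth_on_uminus: "open S \<Longrightarrow> smooth_on S f \<Longrightarrow> smooth_on S (\<lambda>x. - f x)"
  by (rule smooth_on_bounded_linear[OF _ bounded_linear_minus[OF bounded_linear_ident]])

lemma smooth_on_diff: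
  "open S \<Longrightarrow> smooth_on S f \<Longrightarrow> smooth_on S g \<Longrightarrow> smooth_on S (\<lambda>x. f x - g x)"
  using smooth_on_add[of S f "\<lambda>x. - g x"] smooth_on_uminus[of S g] by simp

lemma smooth_on_inner_const: "open S \<Longrightarrow> smooth_on S f \<Longrightarrow> smooth_on S (\<lambda>x. f x \<bullet> e)"
  by (rule smooth_on_bounded_linear[OF _ bounded_linear_inner_left])

lemma smooth_on_inverse:
  fixes f :: "'b::real_normed_vector \<Rightarrow> real"
  shows "open S \<Longrightarrow> smooth_on S f \<Longrightarrow> (\<And>x. x \<in> S \<Longrightarrow> f x \<noteq> 0) \<Longrightarrow> smooth_on S (\<lambda>x. inverse (f x))"
  unfolding smooth_on_def by (simp add: Ck_on_inverse)

lemma smooth_on_sum: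
  "open S \<Longrightarrow> (\<And>i. i \<in> I \<Longrightarrow> smooth_on S (f i)) \<Longrightarrow> smooth_on S (\<lambda>x. \<Sum>i\<in>I. f i x)"
  unfolding smooth_on_def by (simp add: Ck_on_sum)

lemma smooth_on_compose:
  fixes f :: "'a::real_normed_vector \<Rightarrow> 'b::euclidean_space"
  shows "open S \<Longrightarrow> open T \<Longrightarrow> f ` S \<subseteq> T \<Longrightarrow> smooth_on S f \<Longrightarrow> smooth_on T g
    \<Longrightarrow> smooth_on S (\<lambda>x. g (f x))"
  unfolding smooth_on_def by (simp add: Ck_on_compose)

lemma smooth_on_differentiable: "smooth_on S f \<Longrightarrow> x \<in> S \<Longrightarrow> f differentiable (at x)"
  unfolding smooth_on_def by (metis Ck_on.simps(2))

lemma smooth_on_has_derivative: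
  "smooth_on S f \<Longrightarrow> x \<in> S \<Longrightarrow> (f has_derivative frechet_derivative f (at x)) (at x)"
  by (intro has_frechet_derivative smooth_on_differentiable)

lemma smooth_on_frechet_derivative:
  "smooth_on S f \<Longrightarrow> smooth_on S (\<lambda>x. frechet_derivative f (at x) v)"
  unfolding smooth_on_def by (metis Ck_on.simps(2))

lemma smooth_on_imp_continuous_on: "smooth_on S f \<Longrightarrow> continuous_on S f"
  unfolding smooth_on_def using Ck_on_imp_continuous_on by blast

lemma smooth_on_frechet_derivative_apply:
  fixes f :: "'b::euclidean_space \<Rightarrow> 'c::real_normed_vector"
  assumes "open S" "smooth_on S f" "smooth_on S u"
  shows "smooth_on S (\<lambda>x. frechet_derivative f (at x) (u x))"
proof (rule smooth_on_cong[OF assms(1)])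
  show "smooth_on S (\<lambda>x. \<Sum>e\<in>Basis. (u x \<bullet> e) *\<^sub>R frechet_derivative f (at x) e)"
    using assms
    by (intro smooth_on_sum smooth_on_scaleR smooth_on_inner_const smooth_on_frechet_derivative)
  show "(\<Sum>e\<in>Basis. (u x \<bullet> e) *\<^sub>R frechet_derivative f (at x) e) = frechet_derivative f (at x) (u x)"
    if "x \<in> S" for x
    using that assms
    by (intro linear_basis_expand[symmetric] has_derivative_linear[OF smooth_on_has_derivative])
qed

lemma frechet_derivative_linear:
  "smooth_on S f \<Longrightarrow> x \<in> S \<Longrightarrow> linear (frechet_derivative f (at x))"
  by (rule has_derivative_linear[OF smooth_on_has_derivative])

section \<open>Symmetry of second derivatives\<close>

lemma has_real_derivative_line:
  fixes f :: "'b::real_normed_vector \<Rightarrow> real"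
  assumes "(f has_derivative F) (at (a + s *\<^sub>R v))"
  shows "((\<lambda>s. f (a + s *\<^sub>R v)) has_real_derivative F v) (at s)"
proof -
  have "((\<lambda>s. a + s *\<^sub>R v) has_derivative (\<lambda>h. h *\<^sub>R v)) (at s)"
    by (auto intro!: derivative_eq_intros)
  from has_derivative_compose[OF this assms]
  have "((\<lambda>s. f (a + s *\<^sub>R v)) has_derivative (\<lambda>h. F (h *\<^sub>R v))) (at s)" .
  moreover have "F (h *\<^sub>R v) = F v * h" for h
    using has_derivative_linear[OF assms] by (simp add: linear_cmul)
  ultimately show ?thesis by (simp add: has_field_derivative_def)
qed

text \<open>The mean value theorem is used twice: along \<open>v\<close>, for the difference of
  \<open>f\<close> on the two sides of the parallelogram parallel to \<open>v\<close>, and then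
  along \<open>w\<close>, for the derivative of \<open>f\<close> in direction
  \<open>v\<close>.\<close>

lemma second_difference_mvt:
  fixes f :: "'b::real_normed_vector \<Rightarrow> real"
  assumes f: "smooth_on S f" and t: "0 < t"
    and S: "\<And>r s. 0 \<le> r \<Longrightarrow> r \<le> t \<Longrightarrow> 0 \<le> s \<Longrightarrow> s \<le> t \<Longrightarrow> x + s *\<^sub>R v + r *\<^sub>R w \<in> S"
  obtains r s where "0 \<le> r" "r \<le> t" "0 \<le> s" "s \<le> t"
    "f (x + t *\<^sub>R v + t *\<^sub>R w) - f (x + t *\<^sub>R v) - f (x + t *\<^sub>R w) + f x =
       t * t * frechet_derivative (\<lambda>y. frechet_derivative f (at y) v) (at (x + s *\<^sub>R v + r *\<^sub>R w)) w"
proof -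
  let ?D = "\<lambda>y. frechet_derivative f (at y) v"
  have D: "smooth_on S ?D" by (rule smooth_on_frechet_derivative[OF f])
  have 1: "((\<lambda>s. f (x + s *\<^sub>R v + r *\<^sub>R w)) has_real_derivative ?D (x + s *\<^sub>R v + r *\<^sub>R w)) (at s)"
    if "0 \<le> r" "r \<le> t" "0 \<le> s" "s \<le> t" for r s
    using has_real_derivative_line[of f _ "x + r *\<^sub>R w" s v, OF smooth_on_has_derivative[OF f]] S[OF that]
    by (simp add: ac_simps)
  have 2: "((\<lambda>r. ?D (x + s *\<^sub>R v + r *\<^sub>R w)) has_real_derivative
      frechet_derivative ?D (at (x + s *\<^sub>R v + r *\<^sub>R w)) w) (at r)"
    if "0 \<le> r" "r \<le> t" "0 \<le> s" "s \<le> t" for r s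
    by (intro has_real_derivative_line smooth_on_has_derivative[OF D] S that)
  have "((\<lambda>s. f (x + s *\<^sub>R v + t *\<^sub>R w) - f (x + s *\<^sub>R v + 0 *\<^sub>R w)) has_real_derivative
      ?D (x + s *\<^sub>R v + t *\<^sub>R w) - ?D (x + s *\<^sub>R v + 0 *\<^sub>R w)) (at s)"
    if "0 \<le> s" "s \<le> t" for s
    by (intro DERIV_diff 1) (use that t in auto)
  from MVT2[OF t this] obtain s where s: "0 < s" "s < t"
    and eq1: "f (x + t *\<^sub>R v + t *\<^sub>R w) - f (x + t *\<^sub>R v + 0 *\<^sub>R w) - (f (x + 0 *\<^sub>R v + t *\<^sub>R w) - f (x + 0 *\<^sub>R v + 0 *\<^sub>R w))
      = (t - 0) * (?D (x + s *\<^sub>R v + t *\<^sub>R w) - ?D (x + s *\<^sub>R v + 0 *\<^sub>R w))"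
    by blast
  have "((\<lambda>r. ?D (x + s *\<^sub>R v + r *\<^sub>R w)) has_real_derivative
      frechet_derivative ?D (at (x + s *\<^sub>R v + r *\<^sub>R w)) w) (at r)" if "0 \<le> r" "r \<le> t" for r
    by (rule 2) (use s that in auto)
  from MVT2[OF t this] obtain r where r: "0 < r" "r < t"
    and eq2: "?D (x + s *\<^sub>R v + t *\<^sub>R w) - ?D (x + s *\<^sub>R v + 0 *\<^sub>R w)
      = (t - 0) * frechet_derivative ?D (at (x + s *\<^sub>R v + r *\<^sub>R w)) w"
    by blast
  show thesis
    by (rule that[of r s]) (use r s eq1 eq2 in \<open>auto simp: algebra_simps\<close>)
qed

text \<open>The second difference over a parallelogram does not change when \<open>v\<close> and
  \<open>w\<close> are swapped, and by \<open>second_difference_mvt\<close> it is t^2 times either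
  mixed derivative at some point of the parallelogram. Shrinking the parallelogram, continuity
  forces the mixed derivatives at \<open>x\<close> to agree.\<close>

lemma symmetric_second_derivative_real:
  fixes f :: "'b::real_normed_vector \<Rightarrow> real"
  assumes S: "open S" "x \<in> S" and f: "smooth_on S f"
  shows "frechet_derivative (\<lambda>y. frechet_derivative f (at y) v) (at x) w =
    frechet_derivative (\<lambda>y. frechet_derivative f (at y) w) (at x) v"
proof (rule ccontr)
  let ?A = "\<lambda>y. frechet_derivative (\<lambda>y. frechet_derivative f (at y) v) (at y) w"
  let ?B = "\<lambda>y. frechet_derivative (\<lambda>y. frechet_derivative f (at y) w) (at y) v"
  assume neq: "?A x \<noteq> ?B x"
  \<comment> \<open>Half of the supposed gap: two equal numbers, one within \<open>e\<close> of each
    mixed derivative at \<open>x\<close>, would make the gap smaller than itself.\<close>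
  define e where "e = \<bar>?A x - ?B x\<bar> / 2"
  have e: "e > 0" using neq by (simp add: e_def)
  have cont: "isCont (\<lambda>y. frechet_derivative (\<lambda>y. frechet_derivative f (at y) a) (at y) b) x" for a b
    by (rule continuous_on_interior[OF smooth_on_imp_continuous_on[of S]])
      (use S in \<open>auto intro!: smooth_on_frechet_derivative f simp: interior_open\<close>)
  obtain d1 where d1: "0 < d1" "\<And>y. dist y x < d1 \<Longrightarrow> dist (?A y) (?A x) < e"
    using cont[of v w] e unfolding continuous_at_eps_delta by metis
  obtain d2 where d2: "0 < d2" "\<And>y. dist y x < d2 \<Longrightarrow> dist (?B y) (?B x) < e"
    using cont[of w v] e unfolding continuous_at_eps_delta by metis
  obtain d3 where d3: "0 < d3" "\<And>y. dist y x < d3 \<Longrightarrow> y \<in> S"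
    using S unfolding open_dist by metis
  define d where "d = min d1 (min d2 d3)"
  have d0: "0 < d" using d1 d2 d3 by (simp add: d_def)
  \<comment> \<open>Small enough for the parallelogram with sides \<open>t *\<^sub>R v\<close> and
    \<open>t *\<^sub>R w\<close> to stay within distance \<open>d\<close> of \<open>x\<close>; the
    summand 1 keeps the denominator positive when both vectors vanish.\<close>
  define t where "t = d / (norm v + norm w + 1)"
  have pos: "norm v + norm w + 1 > 0" by (smt (verit) norm_ge_zero)
  have t: "0 < t" using d0 pos by (simp add: t_def)
  \<comment> \<open>Stated for any \<open>a\<close>, \<open>b\<close> with the same sum of norms, so
    that it serves both orders of \<open>v\<close> and \<open>w\<close>.\<close>
  have near: "dist (x + s *\<^sub>R a + r *\<^sub>R b) x < d"
    if "0 \<le> r" "r \<le> t" "0 \<le> s" "s \<le> t" "norm a + norm b = norm v + norm w" for r s a b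
  proof -
    have "dist (x + s *\<^sub>R a + r *\<^sub>R b) x = norm (s *\<^sub>R a + r *\<^sub>R b)"
      by (simp add: dist_norm add.assoc)
    also have "\<dots> \<le> s * norm a + r * norm b"
      using norm_triangle_ineq[of "s *\<^sub>R a" "r *\<^sub>R b"] that by simp
    also have "\<dots> \<le> t * norm a + t * norm b"
      using that by (intro add_mono mult_right_mono) auto
    also have "\<dots> = t * (norm v + norm w)" using that by (simp flip: distrib_left)
    also have "\<dots> < t * (norm v + norm w + 1)" using t by simp
    also have "\<dots> = d" using pos by (simp add: t_def)
    finally show ?thesis .
  qed
  obtain r s where 1: "0 \<le> r" "r \<le> t" "0 \<le> s" "s \<le> t"
    "f (x + t *\<^sub>R v + t *\<^sub>R w) - f (x + t *\<^sub>R v) - f (x + t *\<^sub>R w) + f x = t * t * ?A (x + s *\<^sub>R v + r *\<^sub>R w)"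
  proof (rule second_difference_mvt[OF f t, of x v w])
    show "x + s *\<^sub>R v + r *\<^sub>R w \<in> S" if "0 \<le> r" "r \<le> t" "0 \<le> s" "s \<le> t" for r s
      by (rule d3(2)) (use near[OF that, of v w] in \<open>simp add: d_def\<close>)
  qed blast
  obtain r' s' where 2: "0 \<le> r'" "r' \<le> t" "0 \<le> s'" "s' \<le> t"
    "f (x + t *\<^sub>R w + t *\<^sub>R v) - f (x + t *\<^sub>R w) - f (x + t *\<^sub>R v) + f x = t * t * ?B (x + s' *\<^sub>R w + r' *\<^sub>R v)"
  proof (rule second_difference_mvt[OF f t, of x w v])
    show "x + s *\<^sub>R w + r *\<^sub>R v \<in> S" if "0 \<le> r" "r \<le> t" "0 \<le> s" "s \<le> t" for r s
      by (rule d3(2)) (use near[OF that, of w v] in \<open>simp add: d_def\<close>)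
  qed blast
  have "t * t * ?A (x + s *\<^sub>R v + r *\<^sub>R w) = t * t * ?B (x + s' *\<^sub>R w + r' *\<^sub>R v)"
    unfolding 1(5)[symmetric] 2(5)[symmetric] by (simp add: add.commute add.left_commute)
  then have eq: "?A (x + s *\<^sub>R v + r *\<^sub>R w) = ?B (x + s' *\<^sub>R w + r' *\<^sub>R v)"
    using t by simp
  have "dist (?A (x + s *\<^sub>R v + r *\<^sub>R w)) (?A x) < e"
    by (rule d1(2)) (use near[OF 1(1-4), of v w] in \<open>simp add: d_def\<close>)
  moreover have "dist (?B (x + s' *\<^sub>R w + r' *\<^sub>R v)) (?B x) < e"
    by (rule d2(2)) (use near[OF 2(1-4), of w v] in \<open>simp add: d_def\<close>)
  ultimately show False
    using eq unfolding dist_real_def e_def by argo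
qed

lemma frechet_derivative_inner:
  assumes "smooth_on S f" "x \<in> S"
  shows "frechet_derivative (\<lambda>y. f y \<bullet> e) (at x) v = frechet_derivative f (at x) v \<bullet> e"
proof -
  have "((\<lambda>y. f y \<bullet> e) has_derivative (\<lambda>v. frechet_derivative f (at x) v \<bullet> e)) (at x)"
    by (rule bounded_linear.has_derivative[OF bounded_linear_inner_left smooth_on_has_derivative[OF assms]])
  from frechet_derivative_at[OF this] show ?thesis by metis
qed

lemma symmetric_second_derivative:
  fixes f :: "'b::real_normed_vector \<Rightarrow> 'c::euclidean_space"
  assumes S: "open S" "x \<in> S" and f: "smooth_on S f"
  shows "frechet_derivative (\<lambda>y. frechet_derivative f (at y) v) (at x) w =
    frechet_derivative (\<lambda>y. frechet_derivative f (at y) w) (at x) v"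
proof (rule euclidean_eqI)
  fix e :: 'c assume "e \<in> Basis"
  have "frechet_derivative (\<lambda>y. frechet_derivative f (at y) v) (at x) w \<bullet> e =
    frechet_derivative (\<lambda>y. frechet_derivative (\<lambda>y. f y \<bullet> e) (at y) v) (at x) w" for v w
  proof -
    have "frechet_derivative (\<lambda>y. frechet_derivative f (at y) v) (at x) w \<bullet> e =
      frechet_derivative (\<lambda>y. frechet_derivative f (at y) v \<bullet> e) (at x) w"
      using frechet_derivative_inner[OF smooth_on_frechet_derivative[OF f] S(2)] by simp
    also have "frechet_derivative (\<lambda>y. frechet_derivative f (at y) v \<bullet> e) (at x) =
      frechet_derivative (\<lambda>y. frechet_derivative (\<lambda>y. f y \<bullet> e) (at y) v) (at x)"
      by (rule frechet_derivative_cong_open[OF S]) (simp add: frechet_derivative_inner[OF f])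
    finally show ?thesis .
  qed
  then show "frechet_derivative (\<lambda>y. frechet_derivative f (at y) v) (at x) w \<bullet> e =
    frechet_derivative (\<lambda>y. frechet_derivative f (at y) w) (at x) v \<bullet> e"
    using symmetric_second_derivative_real[OF S smooth_on_inner_const[OF S(1) f]] by metis
qed


section \<open>Bump functions\<close>

text \<open>For \<open>p = 1\<close> this is the classical flat function exp(-1/t), extended by 0.
  The polynomial factor makes the family closed under differentiation, so smoothness follows by an
  induction over all \<open>p\<close> at once.\<close>

definition flat_exp :: "real poly \<Rightarrow> real \<Rightarrow> real" where
  "flat_exp p t = (if 0 < t then poly p (inverse t) * exp (- inverse t) else 0)"

lemma poly_times_exp_uminus_tendsto_0:
  fixes p :: "real poly"
  shows "((\<lambda>x. poly p x * exp (- x)) \<longlongrightarrow> 0) at_top"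
proof -
  have "((\<lambda>x. \<Sum>i\<le>degree p. coeff p i * (x ^ i / exp x)) \<longlongrightarrow> (\<Sum>i\<le>degree p. coeff p i * 0)) at_top"
    by (intro tendsto_intros tendsto_power_div_exp_0)
  then show ?thesis
    by (simp add: poly_altdef sum_distrib_right exp_minus divide_inverse mult.assoc)
qed

lemma flat_exp_tendsto_0: "(flat_exp p \<longlongrightarrow> 0) (at 0)"
proof (rule filterlim_split_at)
  show "(flat_exp p \<longlongrightarrow> 0) (at_left 0)"
    by (rule tendsto_eventually) (auto simp: eventually_at flat_exp_def intro: exI[of _ 1])
  have "((\<lambda>t. poly p (inverse t) * exp (- inverse t)) \<longlongrightarrow> 0) (at_right (0::real))"
    by (rule filterlim_compose[OF poly_times_exp_uminus_tendsto_0 filterlim_inverse_at_top_right])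
  moreover have "\<forall>\<^sub>F t in at_right 0. poly p (inverse t) * exp (- inverse t) = flat_exp p t"
    by (auto simp: eventually_at flat_exp_def intro: exI[of _ 1])
  ultimately show "(flat_exp p \<longlongrightarrow> 0) (at_right 0)"
    by (rule Lim_transform_eventually)
qed

text \<open>With s = 1/t one has ds/dt = -s^2, so p(s) exp(-s) has derivative s^2 (p(s) - p'(s))
  exp(-s). The factor s^2 is the polynomial \<open>[:0, 0, 1:]\<close>.\<close>

lemma DERIV_flat_exp:
  "(flat_exp p has_real_derivative flat_exp ([:0, 0, 1:] * (p - pderiv p)) t) (at t)"
proof (cases t "0::real" rule: linorder_cases)
  case less
  have "((\<lambda>t. 0) has_real_derivative 0) (at t)" by simp
  then have "(flat_exp p has_real_derivative 0) (at t)"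
    by (rule has_field_derivative_transform_within_open[where S = "{..<0}"])
      (use less in \<open>auto simp: flat_exp_def\<close>)
  then show ?thesis using less by (simp add: flat_exp_def)
next
  case equal
  \<comment> \<open>The difference quotient at 0 divides by \<open>h\<close>, that is, multiplies
    the polynomial by its variable; so it is again a member of the family and tends to 0.\<close>
  have "((\<lambda>h. flat_exp (pCons 0 p) h) \<longlongrightarrow> 0) (at 0)" by (rule flat_exp_tendsto_0)
  moreover have "flat_exp (pCons 0 p) h = (flat_exp p (0 + h) - flat_exp p 0) / h" for h
    by (simp add: flat_exp_def divide_inverse ac_simps)
  ultimately have "(flat_exp p has_real_derivative 0) (at 0)"
    by (simp add: DERIV_def)
  then show ?thesis using equal by (simp add: flat_exp_def)
next
  case greater
  have "((\<lambda>t. poly p (inverse t) * exp (- inverse t)) has_real_derivative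
      flat_exp ([:0, 0, 1:] * (p - pderiv p)) t) (at t)"
    using greater
    by (auto intro!: derivative_eq_intros poly_DERIV[THEN DERIV_chain2] 
        simp: flat_exp_def power2_eq_square algebra_simps)
  then show ?thesis
    by (rule has_field_derivative_transform_within_open[where S = "{0<..}"])
      (use greater in \<open>auto simp: flat_exp_def\<close>)
qed

lemma smooth_on_flat_exp: "smooth_on UNIV (flat_exp p)"
proof -
  have "Ck_on k (flat_exp p) UNIV" for k
  proof (induction k arbitrary: p)
    case 0
    show ?case
      by (auto intro!: continuous_at_imp_continuous_on DERIV_isCont[OF DERIV_flat_exp])
  next
    case (Suc k)
    have "Ck_on k (\<lambda>t. flat_exp ([:0, 0, 1:] * (p - pderiv p)) t *\<^sub>R v) UNIV" for v
      by (intro Ck_on_scaleR Suc.IH Ck_on_const open_UNIV)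
    moreover have "(flat_exp p has_derivative
        (\<lambda>v. flat_exp ([:0, 0, 1:] * (p - pderiv p)) t *\<^sub>R v)) (at t)" for t
      using DERIV_flat_exp[of p t] by (simp only: has_field_derivative_def real_scaleR_def)
    ultimately show ?case by (intro Ck_on_SucI[OF open_UNIV])
  qed
  then show ?thesis by (simp add: smooth_on_def)
qed

lemma euclidean_bump:
  fixes a :: "'b::euclidean_space"
  assumes "0 < r"
  obtains h :: "'b \<Rightarrow> real" where "smooth_on UNIV h" "\<And>x. 0 \<le> h x" "\<And>x. h x = 0 \<longleftrightarrow> r \<le> dist a x"
proof
  \<comment> \<open>The squared distance is used because the distance itself is not smooth at
    \<open>a\<close>. It is spelled out as a sum over the basis so that the rules for products and
    sums of real functions apply.\<close>
  let ?h = "\<lambda>x. flat_exp 1 (r * r - (\<Sum>e\<in>Basis. ((x - a) \<bullet> e) * ((x - a) \<bullet> e)))"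
  show "smooth_on UNIV ?h"
    by (intro smooth_on_compose[OF _ _ _ _ smooth_on_flat_exp] smooth_on_diff smooth_on_sum
        smooth_on_mult smooth_on_inner_const smooth_on_ident smooth_on_const) auto
  show "0 \<le> ?h x" for x by (simp add: flat_exp_def)
  show "?h x = 0 \<longleftrightarrow> r \<le> dist a x" for x
  proof -
    have "(\<Sum>e\<in>Basis. ((x - a) \<bullet> e) * ((x - a) \<bullet> e)) = dist a x * dist a x"
      unfolding euclidean_inner[symmetric] by (metis dist_commute dist_norm power2_eq_square power2_norm_eq_inner)
    moreover have "r \<le> dist a x \<longleftrightarrow> r * r \<le> dist a x * dist a x"
      using assms abs_le_square_iff[of r "dist a x"] by (simp add: power2_eq_square)
    ultimately show ?thesis by (simp add: flat_exp_def not_less)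
  qed
qed

section \<open>Charts and tangent spaces\<close>

lemma scaleR_fun_apply [simp]: "(r *\<^sub>R f) x = r *\<^sub>R f x"
  by (simp add: scaleR_fun_def)

lemma sum_fun_apply: "(\<Sum>i\<in>I. f i) x = (\<Sum>i\<in>I. f i x)"
  by (induction I rule: infinite_finite_induct) auto

locale smooth_manifold =
  fixes \<A> :: "('a::{t2_space, second_countable_topology}, 'b::euclidean_space) chart set"
  assumes atlas: "smooth_atlas \<A>"
begin

lemma is_chart: "c \<in> \<A> \<Longrightarrow> is_chart c"
  using atlas by (auto simp: smooth_atlas_def)

lemma chart_exists: obtains c where "c \<in> \<A>" "p \<in> dom_chart c"
  using atlas unfolding smooth_atlas_def by blast

lemma open_dom_chart: "c \<in> \<A> \<Longrightarrow> open (dom_chart c)"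
  and open_cod_chart: "c \<in> \<A> \<Longrightarrow> open (cod_chart c)"
  using is_chart by (auto simp: is_chart_def)

lemma chart_homeomorphism:
  "c \<in> \<A> \<Longrightarrow> homeomorphism (dom_chart c) (cod_chart c) (coord c) (inv_chart c)"
  using is_chart by (auto simp: is_chart_def)

lemma inv_chart_coord [simp]: "c \<in> \<A> \<Longrightarrow> p \<in> dom_chart c \<Longrightarrow> inv_chart c (coord c p) = p"
  using chart_homeomorphism unfolding homeomorphism_def by blast

lemma coord_inv_chart [simp]: "c \<in> \<A> \<Longrightarrow> x \<in> cod_chart c \<Longrightarrow> coord c (inv_chart c x) = x"
  using chart_homeomorphism unfolding homeomorphism_def by blast

lemma coord_in_cod [simp]: "p \<in> dom_chart c \<Longrightarrow> coord c p \<in> cod_chart c"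
  by (simp add: cod_chart_def)

lemma inv_chart_in_dom [simp]: "c \<in> \<A> \<Longrightarrow> x \<in> cod_chart c \<Longrightarrow> inv_chart c x \<in> dom_chart c"
  using chart_homeomorphism unfolding homeomorphism_def by blast

text \<open>Presents the image as a preimage under \<open>inv_chart c\<close>, whose continuity then
  gives openness.\<close>

lemma coord_image_eq:
  assumes "c \<in> \<A>"
  shows "coord c ` (dom_chart c \<inter> U) = {x \<in> cod_chart c. inv_chart c x \<in> U}"
proof
  show "{x \<in> cod_chart c. inv_chart c x \<in> U} \<subseteq> coord c ` (dom_chart c \<inter> U)"
    using assms by (auto intro!: image_eqI[where x = "inv_chart c x" for x])
qed (use assms in auto)

lemma open_coord_image:
  assumes "c \<in> \<A>" "open U"
  shows "open (coord c ` (dom_chart c \<inter> U))"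
proof -
  have "continuous_on (cod_chart c) (inv_chart c)"
    using chart_homeomorphism[OF assms(1)] by (simp add: homeomorphism_def)
  from continuous_open_preimage[OF this open_cod_chart[OF assms(1)] assms(2)] show ?thesis
    unfolding coord_image_eq[OF assms(1)] by (simp add: vimage_def Int_def)
qed

lemma smooth_transition:
  "c \<in> \<A> \<Longrightarrow> d \<in> \<A> \<Longrightarrow> smooth_on (coord c ` (dom_chart c \<inter> dom_chart d)) (coord d \<circ> inv_chart c)"
  using atlas by (auto simp: smooth_atlas_def)

lemma smooth_on_change_chart:
  assumes "c \<in> \<A>" "d \<in> \<A>" "smooth_on (coord c ` (dom_chart c \<inter> dom_chart d)) g"
  shows "smooth_on (coord d ` (dom_chart d \<inter> dom_chart c)) (\<lambda>x. g (coord c (inv_chart d x)))"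
proof (rule smooth_on_compose[OF _ _ _ _ assms(3)])
  show "smooth_on (coord d ` (dom_chart d \<inter> dom_chart c)) (\<lambda>x. coord c (inv_chart d x))"
    using smooth_transition[OF assms(2,1)] by (simp add: comp_def)
qed (use assms in \<open>auto intro: open_coord_image open_dom_chart\<close>)

lemma transition_has_derivative:
  assumes "c \<in> \<A>" "d \<in> \<A>" "p \<in> dom_chart c" "p \<in> dom_chart d"
  shows "((\<lambda>x. coord d (inv_chart c x)) has_derivative transition_deriv c d p) (at (coord c p))"
  using smooth_on_has_derivative[OF smooth_transition[OF assms(1,2)], of "coord c p"] assms
  by (simp add: transition_deriv_def comp_def)

lemma linear_transition_deriv:
  "c \<in> \<A> \<Longrightarrow> d \<in> \<A> \<Longrightarrow> p \<in> dom_chart c \<Longrightarrow> p \<in> dom_chart d \<Longrightarrow> linear (transition_deriv c d p)"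
  by (rule has_derivative_linear[OF transition_has_derivative])

lemma transition_deriv_refl:
  assumes "c \<in> \<A>" "p \<in> dom_chart c"
  shows "transition_deriv c c p v = v"
proof -
  have "transition_deriv c c p = frechet_derivative (\<lambda>x. x) (at (coord c p))"
    unfolding transition_deriv_def
    by (rule frechet_derivative_cong_open[OF open_cod_chart[OF assms(1)]]) (use assms in auto)
  then show ?thesis by simp
qed

text \<open>The chain rule for \<open>g\<close> factored through chart \<open>d\<close>. The
  factorisation holds only on the overlap of the charts, which is open and hence enough for a
  derivative.\<close>

lemma has_derivative_change_chart:
  assumes cd: "c \<in> \<A>" "d \<in> \<A>" "p \<in> dom_chart c" "p \<in> dom_chart d"
    and G: "((\<lambda>x. g (inv_chart d x)) has_derivative G) (at (coord d p))"
  shows "((\<lambda>x. g (inv_chart c x)) has_derivative (\<lambda>v. G (transition_deriv c d p v))) (at (coord c p))"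
proof -
  have "((\<lambda>x. g (inv_chart d (coord d (inv_chart c x)))) has_derivative
      (\<lambda>v. G (transition_deriv c d p v))) (at (coord c p))"
    by (rule has_derivative_compose[OF transition_has_derivative[OF cd]]) (use G cd in simp)
  then show ?thesis
    by (rule has_derivative_transform_within_open[OF _ open_coord_image[of c "dom_chart d"]])
      (use cd open_dom_chart in auto)
qed

text \<open>The cocycle rule: both sides are derivatives of \<open>coord e\<close> read in chart
  \<open>c\<close>, one of them computed through \<open>d\<close>.\<close>

lemma transition_deriv_trans:
  assumes "c \<in> \<A>" "d \<in> \<A>" "e \<in> \<A>" "p \<in> dom_chart c" "p \<in> dom_chart d" "p \<in> dom_chart e"
  shows "transition_deriv d e p (transition_deriv c d p v) = transition_deriv c e p v"
proof -
  have "((\<lambda>x. coord e (inv_chart c x)) has_derivative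
      (\<lambda>v. transition_deriv d e p (transition_deriv c d p v))) (at (coord c p))"
    using assms by (intro has_derivative_change_chart[of c d p "coord e"] transition_has_derivative)
  from has_derivative_unique[OF this transition_has_derivative[of c e p]] assms show ?thesis
    by (metis (no_types, lifting))
qed

section \<open>Tangent vectors and their coordinate expansion\<close>

lemma tangent_space_outside:
  assumes "v \<in> tangent_space \<A> p" "c \<notin> \<A> \<or> p \<notin> dom_chart c"
  shows "v c = 0"
proof -
  have "\<forall>c. \<not> (c \<in> \<A> \<and> p \<in> dom_chart c) \<longrightarrow> v c = 0"
    using assms(1) unfolding tangent_space_def mem_Collect_eq by (rule conjunct1)
  from spec[OF this, of c] assms(2) show ?thesis by argo
qed

lemma tangent_space_transition:
  assumes "v \<in> tangent_space \<A> p" "c \<in> \<A>" "d \<in> \<A>" "p \<in> dom_chart c" "p \<in> dom_chart d"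
  shows "v d = transition_deriv c d p (v c)"
proof -
  have "\<forall>c\<in>\<A>. \<forall>d\<in>\<A>. p \<in> dom_chart c \<inter> dom_chart d \<longrightarrow> v d = transition_deriv c d p (v c)"
    using assms(1) unfolding tangent_space_def mem_Collect_eq by (rule conjunct2)
  from bspec[OF bspec[OF this assms(2)] assms(3)] assms(4,5) show ?thesis by simp
qed

lemma tangent_spaceI:
  assumes "\<And>c. c \<notin> \<A> \<or> p \<notin> dom_chart c \<Longrightarrow> v c = 0"
    and "\<And>c d. c \<in> \<A> \<Longrightarrow> d \<in> \<A> \<Longrightarrow> p \<in> dom_chart c \<Longrightarrow> p \<in> dom_chart d
      \<Longrightarrow> v d = transition_deriv c d p (v c)"
  shows "v \<in> tangent_space \<A> p"
  unfolding tangent_space_def mem_Collect_eq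
proof (intro conjI allI ballI impI)
  fix c assume "\<not> (c \<in> \<A> \<and> p \<in> dom_chart c)"
  then show "v c = 0" using assms(1)[of c] by argo
next
  fix c d assume "c \<in> \<A>" "d \<in> \<A>" "p \<in> dom_chart c \<inter> dom_chart d"
  then show "v d = transition_deriv c d p (v c)" using assms(2)[of c d] by simp
qed

lemma subspace_tangent_space: "subspace (tangent_space \<A> p)"
proof (rule subspaceI)
  show "0 \<in> tangent_space \<A> p"
    by (rule tangent_spaceI) (simp_all add: linear_0[OF linear_transition_deriv])
next
  fix v w assume v: "v \<in> tangent_space \<A> p" and w: "w \<in> tangent_space \<A> p"
  show "v + w \<in> tangent_space \<A> p"
    by (rule tangent_spaceI)
      (simp_all add: tangent_space_outside[OF v] tangent_space_outside[OF w]
        tangent_space_transition[OF v, symmetric] tangent_space_transition[OF w, symmetric]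
        linear_add[OF linear_transition_deriv])
next
  fix r :: real and v assume v: "v \<in> tangent_space \<A> p"
  show "r *\<^sub>R v \<in> tangent_space \<A> p"
    by (rule tangent_spaceI)
      (simp_all add: tangent_space_outside[OF v] tangent_space_transition[OF v, symmetric]
        linear_cmul[OF linear_transition_deriv])
qed

text \<open>One chart around \<open>p\<close> determines all other components: by the transition
  rule in charts around \<open>p\<close>, and as 0 in the rest. Identities of tangent vectors can
  thus be checked in a single chart.\<close>

lemma tangent_space_eqI:
  assumes "v \<in> tangent_space \<A> p" "w \<in> tangent_space \<A> p" "c \<in> \<A>" "p \<in> dom_chart c" "v c = w c"
  shows "v = w"
proof
  fix d
  show "v d = w d"
  proof (cases "d \<in> \<A> \<and> p \<in> dom_chart d")
    case True
    then have "v d = transition_deriv c d p (v c)" "w d = transition_deriv c d p (w c)"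
      using assms by (blast intro: tangent_space_transition)+
    then show ?thesis using assms(5) by simp
  next
    case False
    then show ?thesis
      using tangent_space_outside[OF assms(1)] tangent_space_outside[OF assms(2)] by simp
  qed
qed

lemma coord_vector_in_tangent_space:
  "c \<in> \<A> \<Longrightarrow> p \<in> dom_chart c \<Longrightarrow> coord_vector \<A> c v p \<in> tangent_space \<A> p"
  by (rule tangent_spaceI) (auto simp: coord_vector_def transition_deriv_trans)

lemma coord_vector_self: "c \<in> \<A> \<Longrightarrow> p \<in> dom_chart c \<Longrightarrow> coord_vector \<A> c v p c = v"
  by (simp add: coord_vector_def transition_deriv_refl)

lemma tangent_vector_expand:
  assumes "v \<in> tangent_space \<A> p" "c \<in> \<A>" "p \<in> dom_chart c"
  shows "v = (\<Sum>e\<in>Basis. (v c \<bullet> e) *\<^sub>R coord_vector \<A> c e p)"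
  by (rule tangent_space_eqI[OF assms(1) _ assms(2,3)])
    (use assms in \<open>auto simp: sum_fun_apply coord_vector_self euclidean_representation
      intro!: subspace_sum subspace_scale subspace_tangent_space coord_vector_in_tangent_space\<close>)

lemma coord_vector_coord:
  assumes "v \<in> tangent_space \<A> p" "c \<in> \<A>" "p \<in> dom_chart c"
  shows "coord_vector \<A> c (v c) p = v"
  by (rule tangent_space_eqI[OF _ assms])
    (use assms in \<open>auto simp: coord_vector_self coord_vector_in_tangent_space\<close>)

section \<open>Covectors and their coordinate expansion\<close>

lemma cotangent_space_outside: "\<omega> \<in> cotangent_space \<A> p \<Longrightarrow> v \<notin> tangent_space \<A> p \<Longrightarrow> \<omega> v = 0"
  by (simp add: cotangent_space_def)

lemma cotangent_space_add:
  "\<omega> \<in> cotangent_space \<A> p \<Longrightarrow> v \<in> tangent_space \<A> p \<Longrightarrow> w \<in> tangent_space \<A> p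
    \<Longrightarrow> \<omega> (v + w) = \<omega> v + \<omega> w"
  by (simp add: cotangent_space_def)

lemma cotangent_space_scaleR:
  "\<omega> \<in> cotangent_space \<A> p \<Longrightarrow> v \<in> tangent_space \<A> p \<Longrightarrow> \<omega> (r *\<^sub>R v) = r * \<omega> v"
  by (simp add: cotangent_space_def)

lemma cotangent_space_sum:
  assumes "\<omega> \<in> cotangent_space \<A> p" "\<And>i. i \<in> I \<Longrightarrow> v i \<in> tangent_space \<A> p"
  shows "\<omega> (\<Sum>i\<in>I. r i *\<^sub>R v i) = (\<Sum>i\<in>I. r i * \<omega> (v i))"
proof -
  have 0: "\<omega> 0 = 0"
    using cotangent_space_scaleR[OF assms(1) subspace_0[OF subspace_tangent_space], of 0] by simp
  show ?thesis
    using assms(2)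
    by (induction I rule: infinite_finite_induct)
      (auto simp: 0 cotangent_space_add[OF assms(1)] cotangent_space_scaleR[OF assms(1)]
        subspace_sum subspace_scale subspace_tangent_space)
qed

lemma cotangent_space_expand:
  assumes "\<omega> \<in> cotangent_space \<A> p" "v \<in> tangent_space \<A> p" "c \<in> \<A>" "p \<in> dom_chart c"
  shows "\<omega> v = (\<Sum>e\<in>Basis. (v c \<bullet> e) * \<omega> (coord_vector \<A> c e p))"
  by (subst tangent_vector_expand[OF assms(2-4)])
    (rule cotangent_space_sum[OF assms(1) coord_vector_in_tangent_space[OF assms(3,4)]])

lemma subspace_cotangent_space: "subspace (cotangent_space \<A> p)"
  unfolding subspace_def cotangent_space_def by (auto simp: algebra_simps)

lemma coord_covector_in_cotangent_space: "coord_covector \<A> c e p \<in> cotangent_space \<A> p"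
  using subspace_tangent_space[of p]
  by (auto simp: cotangent_space_def coord_covector_def subspace_def inner_add_left)

text \<open>On tangent vectors this is the coordinate expansion. Elsewhere both sides are 0 by the
  convention on covectors, so that they are equal as functions.\<close>

lemma covector_expand:
  assumes "\<omega> \<in> cotangent_space \<A> p" "c \<in> \<A>" "p \<in> dom_chart c"
  shows "\<omega> = (\<Sum>e\<in>Basis. \<omega> (coord_vector \<A> c e p) *\<^sub>R coord_covector \<A> c e p)"
proof
  fix v
  show "\<omega> v = (\<Sum>e\<in>Basis. \<omega> (coord_vector \<A> c e p) *\<^sub>R coord_covector \<A> c e p) v"
    by (cases "v \<in> tangent_space \<A> p")
      (simp_all add: sum_fun_apply coord_covector_def cotangent_space_outside[OF assms(1)]
        cotangent_space_expand[OF assms(1) _ assms(2,3)] mult.commute)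
qed

lemma subspace_gen_tangent_space: "subspace (gen_tangent_space \<A> p)"
  using subspace_tangent_space[of p] subspace_cotangent_space[of p]
  by (auto simp: gen_tangent_space_def subspace_def zero_prod_def)

section \<open>Smooth functions, vector fields and one-forms\<close>

lemma vector_fieldsD: "X \<in> vector_fields \<A> \<Longrightarrow> X p \<in> tangent_space \<A> p"
  by (simp add: vector_fields_def)

lemma vector_field_smooth:
  "X \<in> vector_fields \<A> \<Longrightarrow> c \<in> \<A> \<Longrightarrow> smooth_on (cod_chart c) (\<lambda>x. X (inv_chart c x) c)"
  by (simp add: vector_fields_def vector_smooth_in_def)

lemma vector_field_derivative:
  "X \<in> vector_fields \<A> \<Longrightarrow> c \<in> \<A> \<Longrightarrow> p \<in> dom_chart c \<Longrightarrow>
    ((\<lambda>x. X (inv_chart c x) c) has_derivative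
      frechet_derivative (\<lambda>x. X (inv_chart c x) c) (at (coord c p))) (at (coord c p))"
  by (rule smooth_on_has_derivative[OF vector_field_smooth]) auto

lemma one_formsD: "\<xi> \<in> one_forms \<A> \<Longrightarrow> \<xi> p \<in> cotangent_space \<A> p"
  by (simp add: one_forms_def)

lemma one_form_smooth:
  "\<xi> \<in> one_forms \<A> \<Longrightarrow> c \<in> \<A> \<Longrightarrow> e \<in> Basis
    \<Longrightarrow> smooth_on (cod_chart c) (\<lambda>x. \<xi> (inv_chart c x) (coord_vector \<A> c e (inv_chart c x)))"
  by (simp add: one_forms_def covector_smooth_in_def)

lemma smooth_functionsI:
  "(\<And>c. c \<in> \<A> \<Longrightarrow> smooth_on (cod_chart c) (\<lambda>x. f (inv_chart c x))) \<Longrightarrow> f \<in> smooth_functions \<A>"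
  by (simp add: smooth_functions_def comp_def)

lemma smooth_functionsD:
  "f \<in> smooth_functions \<A> \<Longrightarrow> c \<in> \<A> \<Longrightarrow> smooth_on (cod_chart c) (\<lambda>x. f (inv_chart c x))"
  by (simp add: smooth_functions_def comp_def)

lemma smooth_function_derivative:
  "f \<in> smooth_functions \<A> \<Longrightarrow> c \<in> \<A> \<Longrightarrow> p \<in> dom_chart c \<Longrightarrow>
    ((\<lambda>x. f (inv_chart c x)) has_derivative
      frechet_derivative (\<lambda>x. f (inv_chart c x)) (at (coord c p))) (at (coord c p))"
  by (rule smooth_on_has_derivative[OF smooth_functionsD]) auto

lemma smooth_functions_mult:
  "f \<in> smooth_functions \<A> \<Longrightarrow> g \<in> smooth_functions \<A> \<Longrightarrow> (\<lambda>p. f p * g p) \<in> smooth_functions \<A>"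
  by (rule smooth_functionsI, intro smooth_on_mult open_cod_chart smooth_functionsD)

lemma smooth_functions_add:
  "f \<in> smooth_functions \<A> \<Longrightarrow> g \<in> smooth_functions \<A> \<Longrightarrow> f + g \<in> smooth_functions \<A>"
  by (rule smooth_functionsI, simp, intro smooth_on_add open_cod_chart smooth_functionsD)

lemma smooth_functions_diff:
  "f \<in> smooth_functions \<A> \<Longrightarrow> g \<in> smooth_functions \<A> \<Longrightarrow> f - g \<in> smooth_functions \<A>"
  by (rule smooth_functionsI, simp, intro smooth_on_diff open_cod_chart smooth_functionsD)

lemma subspace_vector_fields: "subspace (vector_fields \<A>)"
  unfolding subspace_def vector_fields_def vector_smooth_in_def
  using subspace_tangent_space
  by (auto simp: subspace_def open_cod_chart
      intro: smooth_on_const smooth_on_add smooth_on_scaleR)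

lemma vector_fields_scale:
  "f \<in> smooth_functions \<A> \<Longrightarrow> X \<in> vector_fields \<A> \<Longrightarrow> (\<lambda>p. f p *\<^sub>R X p) \<in> vector_fields \<A>"
  unfolding vector_fields_def vector_smooth_in_def
  by (auto simp: subspace_scale[OF subspace_tangent_space] open_cod_chart
      intro!: smooth_on_scaleR smooth_functionsD)

lemma subspace_one_forms: "subspace (one_forms \<A>)"
  unfolding subspace_def one_forms_def covector_smooth_in_def
  using subspace_cotangent_space
  by (auto simp: subspace_def open_cod_chart
      intro: smooth_on_const smooth_on_add smooth_on_mult)

lemma pairing_smooth:
  assumes \<xi>: "\<xi> \<in> one_forms \<A>" and X: "X \<in> vector_fields \<A>"
  shows "\<xi> \<cdot> X \<in> smooth_functions \<A>"
proof (rule smooth_functionsI)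
  fix c assume c: "c \<in> \<A>"
  show "smooth_on (cod_chart c) (\<lambda>x. (\<xi> \<cdot> X) (inv_chart c x))"
  proof (rule smooth_on_cong[OF open_cod_chart[OF c]])
    show "smooth_on (cod_chart c) (\<lambda>x. \<Sum>e\<in>Basis. (X (inv_chart c x) c \<bullet> e) *
        \<xi> (inv_chart c x) (coord_vector \<A> c e (inv_chart c x)))"
      using c by (intro smooth_on_sum smooth_on_mult smooth_on_inner_const
          vector_field_smooth[OF X] one_form_smooth[OF \<xi>] open_cod_chart)
    fix x assume "x \<in> cod_chart c"
    then show "(\<Sum>e\<in>Basis. (X (inv_chart c x) c \<bullet> e) *
        \<xi> (inv_chart c x) (coord_vector \<A> c e (inv_chart c x))) = (\<xi> \<cdot> X) (inv_chart c x)"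
      using c by (simp add: act_def cotangent_space_expand[OF one_formsD[OF \<xi>] vector_fieldsD[OF X], symmetric])
  qed
qed

text \<open>The image of chart \<open>d\<close> is covered by two open pieces, coming from
  \<open>U\<close> and from the complement of \<open>K\<close>; on the second one the function is
  0.\<close>

lemma smooth_on_extend_zero:
  fixes F :: "'a \<Rightarrow> 'c::real_normed_vector"
  assumes "d \<in> \<A>" "closed K" "K \<subseteq> U" "open U" "\<And>q. q \<notin> K \<Longrightarrow> F q = 0"
    "smooth_on (coord d ` (dom_chart d \<inter> U)) (\<lambda>x. F (inv_chart d x))"
  shows "smooth_on (cod_chart d) (\<lambda>x. F (inv_chart d x))"
proof (rule smooth_on_local)
  fix x assume x: "x \<in> cod_chart d"
  let ?V = "coord d ` (dom_chart d \<inter> (- K))"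
  have V: "open ?V" using assms by (intro open_coord_image) auto
  have "smooth_on ?V (\<lambda>x. F (inv_chart d x))"
    by (rule smooth_on_cong[OF V _ smooth_on_const[of _ 0]]) (use assms in auto)
  moreover have "x \<in> ?V \<or> x \<in> coord d ` (dom_chart d \<inter> U)"
    using x assms by (auto simp: coord_image_eq)
  ultimately show "\<exists>U. open U \<and> x \<in> U \<and> smooth_on U (\<lambda>x. F (inv_chart d x))"
    using V assms open_coord_image[of d U] by blast
qed

text \<open>A Euclidean bump is pulled back through the chart and extended by 0. Its ball has its
  closed version inside \<open>cod_chart c\<close>, so the support stays away from the edge of the
  chart domain.\<close>

lemma manifold_bump:
  assumes c: "c \<in> \<A>" and p: "p \<in> dom_chart c"
  obtains \<rho> K where "\<rho> \<in> smooth_functions \<A>" "\<rho> p \<noteq> 0" "closed K" "K \<subseteq> dom_chart c"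
    "\<And>q. q \<notin> K \<Longrightarrow> \<rho> q = 0"
proof -
  obtain r where r: "0 < r" "cball (coord c p) r \<subseteq> cod_chart c"
    using open_cod_chart[OF c] coord_in_cod[OF p] by (meson open_contains_cball)
  obtain h :: "'b \<Rightarrow> real" where h: "smooth_on UNIV h" "\<And>x. h x = 0 \<longleftrightarrow> r \<le> dist (coord c p) x"
    using euclidean_bump[OF r(1)] by metis
  define \<rho> where "\<rho> q = (if q \<in> dom_chart c then h (coord c q) else 0)" for q
  define K where "K = inv_chart c ` cball (coord c p) r"
  have "continuous_on (cball (coord c p) r) (inv_chart c)"
    using chart_homeomorphism[OF c] r(2) by (auto simp: homeomorphism_def intro: continuous_on_subset)
  \<comment> \<open>Closed in the whole manifold, not just in the chart domain: a compact set in a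
    Hausdorff space.\<close>
  then have K: "closed K"
    unfolding K_def by (intro compact_imp_closed compact_continuous_image compact_cball)
  have Kc: "K \<subseteq> dom_chart c" using r c unfolding K_def by auto
  have zero: "\<rho> q = 0" if "q \<notin> K" for q
  proof (rule ccontr)
    assume "\<rho> q \<noteq> 0"
    then have q: "q \<in> dom_chart c" "dist (coord c p) (coord c q) < r"
      using h by (auto simp: \<rho>_def split: if_splits)
    then have "q \<in> K" unfolding K_def
      by (intro image_eqI[where x = "coord c q"]) (use c in auto)
    then show False using that by simp
  qed
  have "\<rho> \<in> smooth_functions \<A>"
  proof (rule smooth_functionsI)
    fix d assume d: "d \<in> \<A>"
    show "smooth_on (cod_chart d) (\<lambda>x. \<rho> (inv_chart d x))"
    proof (rule smooth_on_extend_zero[OF d K Kc open_dom_chart[OF c] zero])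
      have "smooth_on (coord d ` (dom_chart d \<inter> dom_chart c)) (\<lambda>x. h (coord c (inv_chart d x)))"
        by (rule smooth_on_change_chart[OF c d smooth_on_subset[OF h(1)]]) simp
      then show "smooth_on (coord d ` (dom_chart d \<inter> dom_chart c)) (\<lambda>x. \<rho> (inv_chart d x))"
        by (rule smooth_on_cong[OF open_coord_image[OF d open_dom_chart[OF c]], rotated])
          (use d in \<open>auto simp: \<rho>_def\<close>)
    qed
  qed
  moreover have "\<rho> p \<noteq> 0" using h(2) r p by (simp add: \<rho>_def not_le)
  ultimately show thesis using K Kc zero that by blast
qed

text \<open>Turns a coordinate field into a global one. Outside \<open>dom_chart c\<close> the value
  of \<open>coord_vector\<close> has no meaning, but there \<open>\<rho>\<close> vanishes; on an
  overlap the components in chart \<open>d\<close> are derivatives of the coordinate change.\<close>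

lemma coord_vector_cutoff:
  assumes c: "c \<in> \<A>" and \<rho>: "\<rho> \<in> smooth_functions \<A>"
    and K: "closed K" "K \<subseteq> dom_chart c" "\<And>q. q \<notin> K \<Longrightarrow> \<rho> q = 0"
  shows "(\<lambda>q. \<rho> q *\<^sub>R coord_vector \<A> c v q) \<in> vector_fields \<A>"
proof -
  have "\<rho> q *\<^sub>R coord_vector \<A> c v q \<in> tangent_space \<A> q" for q
  proof (cases "q \<in> dom_chart c")
    case True
    then show ?thesis
      by (intro subspace_scale subspace_tangent_space coord_vector_in_tangent_space c)
  next
    case False
    then have "\<rho> q = 0" using K(2,3) by blast
    then show ?thesis by (simp add: subspace_0 subspace_tangent_space)
  qed
  moreover have "smooth_on (cod_chart d) (\<lambda>x. \<rho> (inv_chart d x) *\<^sub>R coord_vector \<A> c v (inv_chart d x) d)"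
    if d: "d \<in> \<A>" for d
  proof (rule smooth_on_extend_zero[OF d K(1,2) open_dom_chart[OF c],
        where F = "\<lambda>q. \<rho> q *\<^sub>R coord_vector \<A> c v q d"])
    let ?V = "coord d ` (dom_chart d \<inter> dom_chart c)"
    have V: "open ?V" by (rule open_coord_image[OF d open_dom_chart[OF c]])
    have "smooth_on ?V (\<lambda>x. frechet_derivative (coord d \<circ> inv_chart c) (at (coord c (inv_chart d x))) v)"
      by (rule smooth_on_change_chart[OF c d]) (intro smooth_on_frechet_derivative smooth_transition c d)
    then have "smooth_on ?V (\<lambda>x. coord_vector \<A> c v (inv_chart d x) d)"
      by (rule smooth_on_cong[OF V, rotated]) (use d in \<open>auto simp: coord_vector_def transition_deriv_def\<close>)
    moreover have "smooth_on ?V (\<lambda>x. \<rho> (inv_chart d x))"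
      by (rule smooth_on_subset[OF smooth_functionsD[OF \<rho> d]]) (auto simp: cod_chart_def)
    ultimately show "smooth_on ?V (\<lambda>x. \<rho> (inv_chart d x) *\<^sub>R coord_vector \<A> c v (inv_chart d x) d)"
      using V by (intro smooth_on_scaleR)
  qed (use K in auto)
  ultimately show ?thesis by (simp add: vector_fields_def vector_smooth_in_def)
qed

text \<open>The component \<open>X q c\<close> is set to 0 outside \<open>dom_chart c\<close> and
  may jump at the boundary; the factor \<open>\<rho>\<close> removes the jump.\<close>

lemma coordinate_cutoff:
  assumes c: "c \<in> \<A>" and \<rho>: "\<rho> \<in> smooth_functions \<A>"
    and K: "closed K" "K \<subseteq> dom_chart c" "\<And>q. q \<notin> K \<Longrightarrow> \<rho> q = 0"
    and X: "X \<in> vector_fields \<A>"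
  shows "(\<lambda>q. \<rho> q * (X q c \<bullet> e)) \<in> smooth_functions \<A>"
proof (rule smooth_functionsI)
  fix d assume d: "d \<in> \<A>"
  show "smooth_on (cod_chart d) (\<lambda>x. \<rho> (inv_chart d x) * (X (inv_chart d x) c \<bullet> e))"
  proof (rule smooth_on_extend_zero[OF d K(1,2) open_dom_chart[OF c],
        where F = "\<lambda>q. \<rho> q * (X q c \<bullet> e)"])
    let ?V = "coord d ` (dom_chart d \<inter> dom_chart c)"
    have V: "open ?V" by (rule open_coord_image[OF d open_dom_chart[OF c]])
    have "smooth_on ?V (\<lambda>x. X (inv_chart c (coord c (inv_chart d x))) c)"
      by (rule smooth_on_change_chart[OF c d])
        (rule smooth_on_subset[OF vector_field_smooth[OF X c]], auto simp: cod_chart_def)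
    then have "smooth_on ?V (\<lambda>x. X (inv_chart d x) c)"
      by (rule smooth_on_cong[OF V, rotated]) (use c d in auto)
    moreover have "smooth_on ?V (\<lambda>x. \<rho> (inv_chart d x))"
      by (rule smooth_on_subset[OF smooth_functionsD[OF \<rho> d]]) (auto simp: cod_chart_def)
    ultimately show "smooth_on ?V (\<lambda>x. \<rho> (inv_chart d x) * (X (inv_chart d x) c \<bullet> e))"
      using V by (intro smooth_on_mult smooth_on_inner_const)
  qed (use K in auto)
qed

text \<open>The cut-off field with constant coordinates \<open>v c\<close>, divided by
  \<open>\<rho> p\<close> to restore the value at \<open>p\<close>. It makes pointwise statements
  accessible to hypotheses about global fields.\<close>

lemma tangent_vector_extend:
  assumes "v \<in> tangent_space \<A> p"
  obtains X where "X \<in> vector_fields \<A>" "X p = v"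
proof -
  obtain c where c: "c \<in> \<A>" "p \<in> dom_chart c" by (rule chart_exists)
  obtain \<rho> K where \<rho>: "\<rho> \<in> smooth_functions \<A>" "\<rho> p \<noteq> 0" "closed K" "K \<subseteq> dom_chart c"
    "\<And>q. q \<notin> K \<Longrightarrow> \<rho> q = 0"
    by (rule manifold_bump[OF c]) blast
  show thesis
  proof (rule that)
    show "inverse (\<rho> p) *\<^sub>R (\<lambda>q. \<rho> q *\<^sub>R coord_vector \<A> c (v c) q) \<in> vector_fields \<A>"
      by (intro subspace_scale subspace_vector_fields coord_vector_cutoff[OF c(1) \<rho>(1,3,4)] \<rho>(5))
    show "(inverse (\<rho> p) *\<^sub>R (\<lambda>q. \<rho> q *\<^sub>R coord_vector \<A> c (v c) q)) p = v"
      using \<rho>(2) coord_vector_coord[OF assms c] by simp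
  qed
qed

lemma one_forms_eqI:
  assumes "\<And>p. \<xi> p \<in> cotangent_space \<A> p" "\<And>p. \<eta> p \<in> cotangent_space \<A> p"
    "\<And>Y. Y \<in> vector_fields \<A> \<Longrightarrow> \<xi> \<cdot> Y = \<eta> \<cdot> Y"
  shows "\<xi> = \<eta>"
proof (intro ext)
  fix p v
  show "\<xi> p v = \<eta> p v"
  proof (cases "v \<in> tangent_space \<A> p")
    case True
    then obtain Y where "Y \<in> vector_fields \<A>" "Y p = v" by (rule tangent_vector_extend)
    then show ?thesis using fun_cong[OF assms(3), of Y p] by (simp add: act_def)
  next
    case False
    then show ?thesis using assms(1,2) cotangent_space_outside by metis
  qed
qed

text \<open>Converse to \<open>pairing_smooth\<close>. Near a given point the coefficient of the
  form at a coordinate field is its pairing with the cut-off field, divided by the bump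
  function.\<close>

lemma one_formsI:
  assumes co: "\<And>p. \<xi> p \<in> cotangent_space \<A> p"
    and sm: "\<And>Y. Y \<in> vector_fields \<A> \<Longrightarrow> \<xi> \<cdot> Y \<in> smooth_functions \<A>"
  shows "\<xi> \<in> one_forms \<A>"
proof -
  have "smooth_on (cod_chart c) (\<lambda>x. \<xi> (inv_chart c x) (coord_vector \<A> c e (inv_chart c x)))"
    if c: "c \<in> \<A>" for c e
  proof (rule smooth_on_local)
    fix x assume x: "x \<in> cod_chart c"
    have p: "inv_chart c x \<in> dom_chart c" using c x by simp
    obtain \<rho> K where \<rho>: "\<rho> \<in> smooth_functions \<A>" "\<rho> (inv_chart c x) \<noteq> 0" "closed K" "K \<subseteq> dom_chart c"
      "\<And>q. q \<notin> K \<Longrightarrow> \<rho> q = 0"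
      by (rule manifold_bump[OF c p]) blast
    let ?Y = "\<lambda>q. \<rho> q *\<^sub>R coord_vector \<A> c e q"
    have Y: "?Y \<in> vector_fields \<A>" by (rule coord_vector_cutoff[OF c \<rho>(1,3,4,5)])
    \<comment> \<open>The open set on which division by the bump function is possible.\<close>
    define V where "V = {y \<in> cod_chart c. \<rho> (inv_chart c y) \<noteq> 0}"
    have "continuous_on (cod_chart c) (\<lambda>y. \<rho> (inv_chart c y))"
      by (rule smooth_on_imp_continuous_on[OF smooth_functionsD[OF \<rho>(1) c]])
    from continuous_open_preimage[OF this open_cod_chart[OF c], of "- {0}"]
    have V: "open V" by (simp add: V_def vimage_def Int_def open_Compl)
    have "smooth_on V (\<lambda>y. inverse (\<rho> (inv_chart c y)) * (\<xi> \<cdot> ?Y) (inv_chart c y))"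
      by (intro smooth_on_mult smooth_on_inverse V
          smooth_on_subset[OF smooth_functionsD[OF \<rho>(1) c]]
          smooth_on_subset[OF smooth_functionsD[OF sm[OF Y] c]]) (auto simp: V_def)
    then have "smooth_on V (\<lambda>y. \<xi> (inv_chart c y) (coord_vector \<A> c e (inv_chart c y)))"
      by (rule smooth_on_cong[OF V, rotated])
        (use c in \<open>simp add: V_def act_def cotangent_space_scaleR[OF co] coord_vector_in_tangent_space\<close>)
    then show "\<exists>U. open U \<and> x \<in> U \<and>
        smooth_on U (\<lambda>y. \<xi> (inv_chart c y) (coord_vector \<A> c e (inv_chart c y)))"
      using V x \<rho>(2) unfolding V_def by blast
  qed
  then show ?thesis using co by (simp add: one_forms_def covector_smooth_in_def)
qed

end

section \<open>Lie derivative and Lie bracket\<close>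

text \<open>Product rule for x -> Df(x)(u(x)), obtained from the basis expansion of
  \<open>u x\<close>.\<close>

lemma has_derivative_frechet_derivative_apply:
  fixes f :: "'b::euclidean_space \<Rightarrow> 'c::euclidean_space"
  assumes S: "open S" "x \<in> S" and f: "smooth_on S f" and u: "smooth_on S u"
  shows "((\<lambda>x. frechet_derivative f (at x) (u x)) has_derivative
    (\<lambda>w. frechet_derivative (\<lambda>y. frechet_derivative f (at y) (u x)) (at x) w
       + frechet_derivative f (at x) (frechet_derivative u (at x) w))) (at x)"
proof -
  let ?E = "\<lambda>e w. frechet_derivative (\<lambda>y. frechet_derivative f (at y) e) (at x) w"
  \<comment> \<open>Symmetry moves \<open>v\<close> from the direction of the inner derivative to
    that of the outer one, where linearity is known. This is what allows the basis expansion to be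
    summed up again.\<close>
  have lin: "linear (\<lambda>v. ?E v w)" for w
    unfolding symmetric_second_derivative[OF S f, of _ w]
    by (rule frechet_derivative_linear[OF smooth_on_frechet_derivative[OF f] S(2)])
  have "((\<lambda>x. \<Sum>e\<in>Basis. (u x \<bullet> e) *\<^sub>R frechet_derivative f (at x) e) has_derivative
      (\<lambda>w. \<Sum>e\<in>Basis. (u x \<bullet> e) *\<^sub>R ?E e w
        + (frechet_derivative u (at x) w \<bullet> e) *\<^sub>R frechet_derivative f (at x) e)) (at x)"
    by (intro has_derivative_sum has_derivative_scaleR has_derivative_inner_left
        smooth_on_has_derivative[OF u S(2)]
        smooth_on_has_derivative[OF smooth_on_frechet_derivative[OF f] S(2)])
  moreover have "(\<lambda>w. \<Sum>e\<in>Basis. (u x \<bullet> e) *\<^sub>R ?E e w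
        + (frechet_derivative u (at x) w \<bullet> e) *\<^sub>R frechet_derivative f (at x) e) =
      (\<lambda>w. ?E (u x) w + frechet_derivative f (at x) (frechet_derivative u (at x) w))"
    by (simp only: sum.distrib linear_basis_expand[OF lin, where v = "u x"]
        linear_basis_expand[OF frechet_derivative_linear[OF f S(2)], symmetric])
  ultimately have "((\<lambda>x. \<Sum>e\<in>Basis. (u x \<bullet> e) *\<^sub>R frechet_derivative f (at x) e) has_derivative
      (\<lambda>w. ?E (u x) w + frechet_derivative f (at x) (frechet_derivative u (at x) w))) (at x)"
    by (simp only:)
  then show ?thesis
    by (rule has_derivative_transform_within_open[OF _ S])
      (rule linear_basis_expand[OF frechet_derivative_linear[OF f], symmetric])
qed

context smooth_manifold
begin

text \<open>The definition picks a chart by choice. The chain rule and the transition rule for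
  \<open>X p\<close> compensate each other, so any chart may replace it.\<close>

lemma lie_derivative_chart:
  assumes f: "f \<in> smooth_functions \<A>" and X: "X \<in> vector_fields \<A>"
    and c: "c \<in> \<A>" "p \<in> dom_chart c"
  shows "lie_derivative \<A> X f p =
    frechet_derivative (\<lambda>x. f (inv_chart c x)) (at (coord c p)) (X p c)"
proof -
  define d where "d = (SOME c. c \<in> \<A> \<and> p \<in> dom_chart c)"
  have d: "d \<in> \<A>" "p \<in> dom_chart d"
    using someI[of "\<lambda>c. c \<in> \<A> \<and> p \<in> dom_chart c" c] c unfolding d_def by simp_all
  let ?G = "frechet_derivative (\<lambda>x. f (inv_chart d x)) (at (coord d p))"
  have "((\<lambda>x. f (inv_chart c x)) has_derivative (\<lambda>v. ?G (transition_deriv c d p v))) (at (coord c p))"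
    by (rule has_derivative_change_chart[OF c(1) d(1) c(2) d(2) smooth_function_derivative[OF f d]])
  from has_derivative_unique[OF smooth_function_derivative[OF f c] this]
  have "frechet_derivative (\<lambda>x. f (inv_chart c x)) (at (coord c p)) (X p c) = ?G (X p d)"
    by (simp add: tangent_space_transition[OF vector_fieldsD[OF X] c(1) d(1) c(2) d(2)])
  then show ?thesis
    unfolding lie_derivative_def Let_def d_def[symmetric] comp_def by simp
qed

lemma lie_derivative_smooth:
  assumes f: "f \<in> smooth_functions \<A>" and X: "X \<in> vector_fields \<A>"
  shows "lie_derivative \<A> X f \<in> smooth_functions \<A>"
proof (rule smooth_functionsI)
  fix c assume c: "c \<in> \<A>"
  show "smooth_on (cod_chart c) (\<lambda>x. lie_derivative \<A> X f (inv_chart c x))"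
  proof (rule smooth_on_cong[OF open_cod_chart[OF c]])
    show "smooth_on (cod_chart c)
        (\<lambda>x. frechet_derivative (\<lambda>x. f (inv_chart c x)) (at x) (X (inv_chart c x) c))"
      by (intro smooth_on_frechet_derivative_apply open_cod_chart c vector_field_smooth[OF X]
          smooth_functionsD[OF f])
  qed (simp add: lie_derivative_chart[OF f X c] c)
qed

lemma lie_derivative_mult:
  assumes f: "f \<in> smooth_functions \<A>" and g: "g \<in> smooth_functions \<A>"
    and X: "X \<in> vector_fields \<A>"
  shows "lie_derivative \<A> X (\<lambda>p. f p * g p) p = lie_derivative \<A> X f p * g p + f p * lie_derivative \<A> X g p"
proof -
  obtain c where c: "c \<in> \<A>" "p \<in> dom_chart c" by (rule chart_exists)
  note h = smooth_functions_mult[OF f g]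
  have "((\<lambda>x. f (inv_chart c x) * g (inv_chart c x)) has_derivative
      (\<lambda>v. f p * frechet_derivative (\<lambda>x. g (inv_chart c x)) (at (coord c p)) v
        + frechet_derivative (\<lambda>x. f (inv_chart c x)) (at (coord c p)) v * g p)) (at (coord c p))"
    using has_derivative_mult[OF smooth_function_derivative[OF f c] smooth_function_derivative[OF g c]] c
    by simp
  from has_derivative_unique[OF smooth_function_derivative[OF h c] this] show ?thesis
    by (simp add: lie_derivative_chart[OF f X c]
        lie_derivative_chart[OF g X c]
        lie_derivative_chart[OF h X c])
qed

lemma lie_derivative_add:
  assumes f: "f \<in> smooth_functions \<A>" and g: "g \<in> smooth_functions \<A>"
    and X: "X \<in> vector_fields \<A>"
  shows "lie_derivative \<A> X (f + g) = lie_derivative \<A> X f + lie_derivative \<A> X g"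
proof
  fix p
  obtain c where c: "c \<in> \<A>" "p \<in> dom_chart c" by (rule chart_exists)
  note h = smooth_functions_add[OF f g]
  have "((\<lambda>x. (f + g) (inv_chart c x)) has_derivative
      (\<lambda>v. frechet_derivative (\<lambda>x. f (inv_chart c x)) (at (coord c p)) v
        + frechet_derivative (\<lambda>x. g (inv_chart c x)) (at (coord c p)) v)) (at (coord c p))"
    using has_derivative_add[OF smooth_function_derivative[OF f c] smooth_function_derivative[OF g c]]
    by simp
  from has_derivative_unique[OF smooth_function_derivative[OF h c] this]
  show "lie_derivative \<A> X (f + g) p = (lie_derivative \<A> X f + lie_derivative \<A> X g) p"
    by (simp add: lie_derivative_chart[OF f X c]
        lie_derivative_chart[OF g X c]
        lie_derivative_chart[OF h X c])
qed

lemma lie_derivative_add_field: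
  assumes f: "f \<in> smooth_functions \<A>" and X: "X \<in> vector_fields \<A>" and Y: "Y \<in> vector_fields \<A>"
  shows "lie_derivative \<A> (X + Y) f = lie_derivative \<A> X f + lie_derivative \<A> Y f"
proof
  fix p
  obtain c where c: "c \<in> \<A>" "p \<in> dom_chart c" by (rule chart_exists)
  note XY = subspace_add[OF subspace_vector_fields X Y]
  show "lie_derivative \<A> (X + Y) f p = (lie_derivative \<A> X f + lie_derivative \<A> Y f) p"
    by (simp add: lie_derivative_chart[OF f X c]
        lie_derivative_chart[OF f Y c]
        lie_derivative_chart[OF f XY c]
        linear_add[OF has_derivative_linear[OF smooth_function_derivative[OF f c]]])
qed

text \<open>With \<tau> the coordinate change, the \<open>d\<close>-components of \<open>X\<close>
  are D\<tau>(X_c). Their derivative, read in chart \<open>c\<close>, is computed once by the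
  product rule and once through chart \<open>d\<close>. The term with the second derivative of
  \<tau> is the failure of the derivative of a field to be a tangent vector.\<close>

lemma vector_field_derivative_transition:
  assumes X: "X \<in> vector_fields \<A>"
    and cd: "c \<in> \<A>" "d \<in> \<A>" "p \<in> dom_chart c" "p \<in> dom_chart d"
  shows "frechet_derivative (\<lambda>x. X (inv_chart d x) d) (at (coord d p)) (transition_deriv c d p w) =
    frechet_derivative (\<lambda>y. frechet_derivative (coord d \<circ> inv_chart c) (at y) (X p c)) (at (coord c p)) w
    + transition_deriv c d p (frechet_derivative (\<lambda>x. X (inv_chart c x) c) (at (coord c p)) w)"
proof -
  let ?S = "coord c ` (dom_chart c \<inter> dom_chart d)"
  let ?\<tau> = "coord d \<circ> inv_chart c"
  let ?Xc = "\<lambda>x. X (inv_chart c x) c"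
  have S: "open ?S" "coord c p \<in> ?S"
    using cd open_coord_image open_dom_chart by auto
  have "smooth_on ?S ?Xc"
    by (rule smooth_on_subset[OF vector_field_smooth[OF X cd(1)]]) (auto simp: cod_chart_def)
  from has_derivative_frechet_derivative_apply[OF S smooth_transition[OF cd(1,2)] this]
  have "((\<lambda>x. frechet_derivative ?\<tau> (at x) (?Xc x)) has_derivative
      (\<lambda>w. frechet_derivative (\<lambda>y. frechet_derivative ?\<tau> (at y) (X p c)) (at (coord c p)) w
        + transition_deriv c d p (frechet_derivative ?Xc (at (coord c p)) w))) (at (coord c p))"
    using cd by (simp add: transition_deriv_def)
  then have 1: "((\<lambda>x. X (inv_chart c x) d) has_derivative
      (\<lambda>w. frechet_derivative (\<lambda>y. frechet_derivative ?\<tau> (at y) (X p c)) (at (coord c p)) w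
        + transition_deriv c d p (frechet_derivative ?Xc (at (coord c p)) w))) (at (coord c p))"
  proof (rule has_derivative_transform_within_open[OF _ S])
    fix x assume "x \<in> ?S"
    then obtain q where q: "q \<in> dom_chart c" "q \<in> dom_chart d" "x = coord c q" by auto
    then show "frechet_derivative ?\<tau> (at x) (?Xc x) = X (inv_chart c x) d"
      using tangent_space_transition[OF vector_fieldsD[OF X] cd(1,2) q(1,2)] cd
      by (simp add: transition_deriv_def)
  qed
  have 2: "((\<lambda>x. X (inv_chart c x) d) has_derivative
      (\<lambda>w. frechet_derivative (\<lambda>x. X (inv_chart d x) d) (at (coord d p)) (transition_deriv c d p w)))
      (at (coord c p))"
    by (rule has_derivative_change_chart[OF cd, where g = "\<lambda>q. X q d"])
      (rule vector_field_derivative[OF X cd(2,4)])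
  from has_derivative_unique[OF 2 1] show ?thesis by (rule fun_cong)
qed

text \<open>The two second-derivative terms of the coordinate change, one from each half of the
  bracket, differ by exchanging \<open>X p c\<close> and \<open>Y p c\<close>, so they
  cancel.\<close>

lemma lie_bracket_in_tangent_space:
  assumes X: "X \<in> vector_fields \<A>" and Y: "Y \<in> vector_fields \<A>"
  shows "lie_bracket \<A> X Y p \<in> tangent_space \<A> p"
proof (rule tangent_spaceI)
  fix c assume "c \<notin> \<A> \<or> p \<notin> dom_chart c"
  then show "lie_bracket \<A> X Y p c = 0" by (auto simp: lie_bracket_def)
next
  fix c d assume cd: "c \<in> \<A>" "d \<in> \<A>" "p \<in> dom_chart c" "p \<in> dom_chart d"
  let ?S = "coord c ` (dom_chart c \<inter> dom_chart d)"
  have S: "open ?S" "coord c p \<in> ?S"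
    using cd open_coord_image open_dom_chart by auto
  let ?B = "\<lambda>v w. frechet_derivative (\<lambda>y. frechet_derivative (coord d \<circ> inv_chart c) (at y) v) (at (coord c p)) w"
  have sym: "?B (X p c) (Y p c) = ?B (Y p c) (X p c)"
    by (rule symmetric_second_derivative[OF S smooth_transition[OF cd(1,2)]])
  have "X p d = transition_deriv c d p (X p c)" "Y p d = transition_deriv c d p (Y p c)"
    using cd by (auto intro: tangent_space_transition vector_fieldsD X Y)
  then show "lie_bracket \<A> X Y p d = transition_deriv c d p (lie_bracket \<A> X Y p c)"
    using cd sym by (simp add: lie_bracket_def vector_field_derivative_transition[OF X cd]
        vector_field_derivative_transition[OF Y cd] linear_diff[OF linear_transition_deriv])
qed

text \<open>Swapping the fields swaps the two derivative terms. Charts are pairs;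
  \<open>split_paired_All\<close> is removed to keep the quantified chart in one piece.\<close>

lemma lie_bracket_antisym: "lie_bracket \<A> X Y = - lie_bracket \<A> Y X"
  by (simp add: lie_bracket_def fun_eq_iff del: split_paired_All)

lemma lie_bracket_add_left:
  assumes X: "X \<in> vector_fields \<A>" and X': "X' \<in> vector_fields \<A>" and Y: "Y \<in> vector_fields \<A>"
  shows "lie_bracket \<A> (X + X') Y = lie_bracket \<A> X Y + lie_bracket \<A> X' Y"
proof (intro ext)
  fix p c
  show "lie_bracket \<A> (X + X') Y p c = (lie_bracket \<A> X Y + lie_bracket \<A> X' Y) p c"
  proof (cases "c \<in> \<A> \<and> p \<in> dom_chart c")
    case True
    then have c: "c \<in> \<A>" "p \<in> dom_chart c" by auto
    have "((\<lambda>x. (X + X') (inv_chart c x) c) has_derivative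
      (\<lambda>v. frechet_derivative (\<lambda>x. X (inv_chart c x) c) (at (coord c p)) v
        + frechet_derivative (\<lambda>x. X' (inv_chart c x) c) (at (coord c p)) v)) (at (coord c p))"
      using has_derivative_add[OF vector_field_derivative[OF X c] vector_field_derivative[OF X' c]]
      by simp
    from has_derivative_unique[OF vector_field_derivative[OF subspace_add[OF subspace_vector_fields X X'] c] this]
    show ?thesis
      using c by (simp add: lie_bracket_def
          linear_add[OF has_derivative_linear[OF vector_field_derivative[OF Y c]]])
  next
    case False
    then show ?thesis by (auto simp: lie_bracket_def)
  qed
qed

lemma lie_bracket_add_right:
  assumes "X \<in> vector_fields \<A>" "Y \<in> vector_fields \<A>" "Y' \<in> vector_fields \<A>"
  shows "lie_bracket \<A> X (Y + Y') = lie_bracket \<A> X Y + lie_bracket \<A> X Y'"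
  using lie_bracket_add_left[OF assms(2,3,1)] lie_bracket_antisym[of X] by simp

section \<open>The dual connection\<close>

lemma tensorial_sum:
  fixes F :: "('a, 'b) vfield \<Rightarrow> 'a \<Rightarrow> real"
  assumes add: "\<And>X Y. X \<in> vector_fields \<A> \<Longrightarrow> Y \<in> vector_fields \<A> \<Longrightarrow> F (X + Y) = F X + F Y"
    and X: "\<And>i. i \<in> I \<Longrightarrow> X i \<in> vector_fields \<A>"
  shows "F (\<Sum>i\<in>I. X i) = (\<Sum>i\<in>I. F (X i))"
proof -
  have 0: "F 0 = 0"
    using add[OF subspace_0 subspace_0, OF subspace_vector_fields subspace_vector_fields] by simp
  show ?thesis
    using X
    by (induction I rule: infinite_finite_induct)
      (auto simp: 0 add subspace_sum subspace_vector_fields)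
qed

text \<open>The standard argument that a C^\<infinity>-linear map is local and pointwise: a field
  vanishing at \<open>p\<close> is, up to a cutoff, a combination of global fields whose
  coefficients vanish at \<open>p\<close>.\<close>

lemma tensorial_zero:
  fixes F :: "('a, 'b) vfield \<Rightarrow> 'a \<Rightarrow> real"
  assumes add: "\<And>X Y. X \<in> vector_fields \<A> \<Longrightarrow> Y \<in> vector_fields \<A> \<Longrightarrow> F (X + Y) = F X + F Y"
    and scale: "\<And>f X. f \<in> smooth_functions \<A> \<Longrightarrow> X \<in> vector_fields \<A>
      \<Longrightarrow> F (\<lambda>p. f p *\<^sub>R X p) = (\<lambda>p. f p * F X p)"
    and Y: "Y \<in> vector_fields \<A>" and zero: "Y p = 0"
  shows "F Y p = 0"
proof -
  obtain c where c: "c \<in> \<A>" "p \<in> dom_chart c" by (rule chart_exists)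
  obtain \<rho> K where \<rho>: "\<rho> \<in> smooth_functions \<A>" "\<rho> p \<noteq> 0" "closed K" "K \<subseteq> dom_chart c"
    "\<And>q. q \<notin> K \<Longrightarrow> \<rho> q = 0"
    by (rule manifold_bump[OF c]) blast
  define E where "E e = (\<lambda>q. \<rho> q *\<^sub>R coord_vector \<A> c e q)" for e
  define f where "f e = (\<lambda>q. \<rho> q * (Y q c \<bullet> e))" for e
  have E: "E e \<in> vector_fields \<A>" for e
    unfolding E_def by (rule coord_vector_cutoff[OF c(1) \<rho>(1,3,4,5)])
  have f: "f e \<in> smooth_functions \<A>" for e
    unfolding f_def by (rule coordinate_cutoff[OF c(1) \<rho>(1,3,4,5) Y])
  \<comment> \<open>The square supplies two cutoffs, one to make the coefficient a global function
    and one to make the coordinate field global.\<close>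
  have "(\<rho> q * \<rho> q) *\<^sub>R Y q = (\<Sum>e\<in>Basis. f e q *\<^sub>R E e q)" for q
  proof (cases "q \<in> dom_chart c")
    case True
    have "(\<rho> q * \<rho> q) *\<^sub>R (\<Sum>e\<in>Basis. (Y q c \<bullet> e) *\<^sub>R coord_vector \<A> c e q) = (\<Sum>e\<in>Basis. f e q *\<^sub>R E e q)"
      by (simp add: scaleR_sum_right f_def E_def ac_simps)
    then show ?thesis
      using tangent_vector_expand[OF vector_fieldsD[OF Y] c(1) True] by simp
  next
    case False
    then have "\<rho> q = 0" using \<rho>(4,5) by blast
    then show ?thesis by (simp add: E_def)
  qed
  then have "(\<lambda>q. (\<rho> q * \<rho> q) *\<^sub>R Y q) = (\<Sum>e\<in>Basis. (\<lambda>q. f e q *\<^sub>R E e q))"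
    by (intro HOL.ext[where f = "\<lambda>q. (\<rho> q * \<rho> q) *\<^sub>R Y q"]) (simp only: sum_fun_apply)
  then have "F (\<lambda>q. (\<rho> q * \<rho> q) *\<^sub>R Y q) p = F (\<Sum>e\<in>Basis. (\<lambda>q. f e q *\<^sub>R E e q)) p"
    by simp
  also have "\<dots> = (\<Sum>e\<in>Basis. F (\<lambda>q. f e q *\<^sub>R E e q)) p"
    by (subst tensorial_sum[OF add]) (auto intro: vector_fields_scale f E)
  also have "\<dots> = (\<Sum>e\<in>Basis. f e p * F (E e) p)"
    by (simp add: sum_fun_apply scale f E)
  also have "\<dots> = 0" by (simp add: f_def zero)
  finally show ?thesis
    using \<rho>(2) scale[OF smooth_functions_mult[OF \<rho>(1,1)] Y] by simp
qed

lemma tensorial_one_form: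
  fixes F :: "('a, 'b) vfield \<Rightarrow> 'a \<Rightarrow> real"
  assumes smooth: "\<And>X. X \<in> vector_fields \<A> \<Longrightarrow> F X \<in> smooth_functions \<A>"
    and add: "\<And>X Y. X \<in> vector_fields \<A> \<Longrightarrow> Y \<in> vector_fields \<A> \<Longrightarrow> F (X + Y) = F X + F Y"
    and scale: "\<And>f X. f \<in> smooth_functions \<A> \<Longrightarrow> X \<in> vector_fields \<A>
      \<Longrightarrow> F (\<lambda>p. f p *\<^sub>R X p) = (\<lambda>p. f p * F X p)"
  obtains \<omega> where "\<omega> \<in> one_forms \<A>" "\<And>Y. Y \<in> vector_fields \<A> \<Longrightarrow> \<omega> \<cdot> Y = F Y"
proof -
  \<comment> \<open>Evaluates \<open>F\<close> on an arbitrary global extension of \<open>v\<close>;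
    two extensions differ by a field vanishing at \<open>p\<close>, so the choice does not
    matter.\<close>
  define \<omega> where "\<omega> p v = (if v \<in> tangent_space \<A> p
    then F (SOME Y. Y \<in> vector_fields \<A> \<and> Y p = v) p else 0)" for p v
  have \<omega>: "\<omega> p (Y p) = F Y p" if Y: "Y \<in> vector_fields \<A>" for Y p
  proof -
    define Z where "Z = (SOME Z. Z \<in> vector_fields \<A> \<and> Z p = Y p)"
    have Z: "Z \<in> vector_fields \<A>" "Z p = Y p"
      using someI[of "\<lambda>Z. Z \<in> vector_fields \<A> \<and> Z p = Y p" Y] Y unfolding Z_def by simp_all
    have YZ: "Y - Z \<in> vector_fields \<A>" by (rule subspace_diff[OF subspace_vector_fields Y Z(1)])
    have "F Y p = F ((Y - Z) + Z) p" by simp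
    also have "\<dots> = F (Y - Z) p + F Z p" by (simp only: add[OF YZ Z(1)] plus_fun_apply)
    also have "F (Y - Z) p = 0"
      by (rule tensorial_zero[OF add scale YZ]) (simp_all add: Z)
    finally show ?thesis using vector_fieldsD[OF Y, of p] by (simp add: \<omega>_def Z_def)
  qed
  \<comment> \<open>Constants are smooth functions, so homogeneity over the reals is a case of the
    scaling rule for \<open>F\<close>.\<close>
  have const: "(\<lambda>_. r) \<in> smooth_functions \<A>" for r :: real
    by (rule smooth_functionsI) (rule smooth_on_const)
  have co: "\<omega> p \<in> cotangent_space \<A> p" for p
    unfolding cotangent_space_def mem_Collect_eq
  proof (intro conjI ballI allI impI)
    fix v w assume "v \<in> tangent_space \<A> p" "w \<in> tangent_space \<A> p"
    then obtain X Y where "X \<in> vector_fields \<A>" "X p = v" "Y \<in> vector_fields \<A>" "Y p = w"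
      by (metis tangent_vector_extend)
    then show "\<omega> p (v + w) = \<omega> p v + \<omega> p w"
      using \<omega>[of "X + Y" p] by (auto simp: \<omega> add subspace_add[OF subspace_vector_fields])
  next
    fix r :: real and v assume "v \<in> tangent_space \<A> p"
    then obtain X where "X \<in> vector_fields \<A>" "X p = v" by (rule tangent_vector_extend)
    then show "\<omega> p (r *\<^sub>R v) = r * \<omega> p v"
      using \<omega>[OF vector_fields_scale[OF const[of r], of X], of p] by (auto simp: \<omega> scale[OF const])
  qed (simp add: \<omega>_def)
  have eq: "\<omega> \<cdot> Y = F Y" if "Y \<in> vector_fields \<A>" for Y
    using \<omega>[OF that] by (simp add: act_def)
  have "\<omega> \<in> one_forms \<A>" by (rule one_formsI[OF co]) (simp add: eq smooth)
  then show thesis using eq by (rule that)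
qed

end

locale manifold_connection = smooth_manifold \<A>
  for \<A> :: "('a::{t2_space, second_countable_topology}, 'b::euclidean_space) chart set" +
  fixes D :: "('a, 'b) vfield \<Rightarrow> ('a, 'b) vfield \<Rightarrow> ('a, 'b) vfield"
  assumes connection: "affine_connection \<A> D"
begin

lemma connection_in: "X \<in> vector_fields \<A> \<Longrightarrow> Y \<in> vector_fields \<A> \<Longrightarrow> D X Y \<in> vector_fields \<A>"
  and connection_add_left: "X \<in> vector_fields \<A> \<Longrightarrow> X' \<in> vector_fields \<A> \<Longrightarrow> Y \<in> vector_fields \<A>
    \<Longrightarrow> D (X + X') Y = D X Y + D X' Y"
  and connection_add_right: "X \<in> vector_fields \<A> \<Longrightarrow> Y \<in> vector_fields \<A> \<Longrightarrow> Y' \<in> vector_fields \<A>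
    \<Longrightarrow> D X (Y + Y') = D X Y + D X Y'"
  and connection_leibniz: "f \<in> smooth_functions \<A> \<Longrightarrow> X \<in> vector_fields \<A> \<Longrightarrow> Y \<in> vector_fields \<A>
    \<Longrightarrow> D X (\<lambda>p. f p *\<^sub>R Y p) = (\<lambda>p. lie_derivative \<A> X f p *\<^sub>R Y p + f p *\<^sub>R D X Y p)"
  using connection unfolding affine_connection_def by blast+

lemma act_add_field:
  "\<xi> \<in> one_forms \<A> \<Longrightarrow> X \<in> vector_fields \<A> \<Longrightarrow> Y \<in> vector_fields \<A> \<Longrightarrow> \<xi> \<cdot> (X + Y) = \<xi> \<cdot> X + \<xi> \<cdot> Y"
  by (simp add: act_def fun_eq_iff cotangent_space_add[OF one_formsD vector_fieldsD vector_fieldsD])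

text \<open>The defining expression is C^\<infinity>-linear in \<open>Y\<close>: replacing
  \<open>Y\<close> by f Y produces the term (X f) \<xi>(Y) both in the Lie derivative and in
  \<xi>(\<nabla>_X(f Y)), and the two cancel.\<close>

lemma dual_connection_exists:
  assumes X: "X \<in> vector_fields \<A>" and \<xi>: "\<xi> \<in> one_forms \<A>"
  obtains \<omega> where "\<omega> \<in> one_forms \<A>"
    "\<And>Y. Y \<in> vector_fields \<A> \<Longrightarrow> \<omega> \<cdot> Y = lie_derivative \<A> X (\<xi> \<cdot> Y) - \<xi> \<cdot> D X Y"
proof (rule tensorial_one_form)
  show "lie_derivative \<A> X (\<xi> \<cdot> Y) - \<xi> \<cdot> D X Y \<in> smooth_functions \<A>"
    if "Y \<in> vector_fields \<A>" for Y
    by (intro smooth_functions_diff lie_derivative_smooth pairing_smooth connection_in X \<xi> that)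
  show "lie_derivative \<A> X (\<xi> \<cdot> (Y + Z)) - \<xi> \<cdot> D X (Y + Z) =
      lie_derivative \<A> X (\<xi> \<cdot> Y) - \<xi> \<cdot> D X Y + (lie_derivative \<A> X (\<xi> \<cdot> Z) - \<xi> \<cdot> D X Z)"
    if "Y \<in> vector_fields \<A>" "Z \<in> vector_fields \<A>" for Y Z
    using that X \<xi> by (simp add: act_add_field connection_add_right connection_in
        lie_derivative_add pairing_smooth)
  show "lie_derivative \<A> X (\<xi> \<cdot> (\<lambda>p. f p *\<^sub>R Y p)) - \<xi> \<cdot> D X (\<lambda>p. f p *\<^sub>R Y p) =
      (\<lambda>p. f p * (lie_derivative \<A> X (\<xi> \<cdot> Y) - \<xi> \<cdot> D X Y) p)"
    if f: "f \<in> smooth_functions \<A>" and Y: "Y \<in> vector_fields \<A>" for f Y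
  proof -
    have 1: "\<xi> \<cdot> (\<lambda>p. f p *\<^sub>R Y p) = (\<lambda>p. f p * (\<xi> \<cdot> Y) p)"
      by (simp add: act_def cotangent_space_scaleR[OF one_formsD[OF \<xi>] vector_fieldsD[OF Y]])
    have 2: "(\<xi> \<cdot> D X (\<lambda>p. f p *\<^sub>R Y p)) p = lie_derivative \<A> X f p * (\<xi> \<cdot> Y) p + f p * (\<xi> \<cdot> D X Y) p" for p
      by (simp add: act_def connection_leibniz[OF f X Y]
          cotangent_space_scaleR[OF one_formsD[OF \<xi>]] cotangent_space_add[OF one_formsD[OF \<xi>]]
          subspace_scale subspace_tangent_space vector_fieldsD connection_in X Y)
    show ?thesis
      by (rule ext) (simp add: 1 2 lie_derivative_mult[OF f pairing_smooth[OF \<xi> Y] X] algebra_simps)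
  qed
qed (use that in blast)

text \<open>Uniqueness holds because the pairings with global fields determine a one-form.
  Additivity of the dual connection is later read off from this rule.\<close>

lemma dual_connection_eqI:
  assumes "\<omega> \<in> one_forms \<A>"
    "\<And>Y. Y \<in> vector_fields \<A> \<Longrightarrow> \<omega> \<cdot> Y = lie_derivative \<A> X (\<xi> \<cdot> Y) - \<xi> \<cdot> D X Y"
  shows "dual_connection \<A> D X \<xi> = \<omega>"
  unfolding dual_connection_def
proof (rule the_equality)
  fix \<omega>' assume \<omega>': "\<omega>' \<in> one_forms \<A> \<and>
    (\<forall>Y\<in>vector_fields \<A>. \<omega>' \<cdot> Y = lie_derivative \<A> X (\<xi> \<cdot> Y) - \<xi> \<cdot> D X Y)"
  show "\<omega>' = \<omega>"
    by (rule one_forms_eqI) (use assms \<omega>' in \<open>auto intro: one_formsD\<close>)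
qed (use assms in blast)

lemma dual_connection_in: "X \<in> vector_fields \<A> \<Longrightarrow> \<xi> \<in> one_forms \<A> \<Longrightarrow> dual_connection \<A> D X \<xi> \<in> one_forms \<A>"
  and dual_connection_act: "X \<in> vector_fields \<A> \<Longrightarrow> \<xi> \<in> one_forms \<A> \<Longrightarrow> Y \<in> vector_fields \<A>
    \<Longrightarrow> dual_connection \<A> D X \<xi> \<cdot> Y = lie_derivative \<A> X (\<xi> \<cdot> Y) - \<xi> \<cdot> D X Y"
  by (metis dual_connection_exists dual_connection_eqI)+

lemma act_add: "(A + B) \<cdot> s = A \<cdot> s + B \<cdot> s"
  by (simp add: act_def fun_eq_iff)

lemma dual_connection_add_left:
  assumes "X \<in> vector_fields \<A>" "X' \<in> vector_fields \<A>" "\<xi> \<in> one_forms \<A>"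
  shows "dual_connection \<A> D (X + X') \<xi> = dual_connection \<A> D X \<xi> + dual_connection \<A> D X' \<xi>"
  by (rule dual_connection_eqI)
    (use assms in \<open>simp_all add: subspace_add subspace_one_forms dual_connection_in act_add
      dual_connection_act lie_derivative_add_field pairing_smooth connection_add_left
      connection_in act_add_field\<close>)

lemma dual_connection_add_right:
  assumes "X \<in> vector_fields \<A>" "\<xi> \<in> one_forms \<A>" "\<eta> \<in> one_forms \<A>"
  shows "dual_connection \<A> D X (\<xi> + \<eta>) = dual_connection \<A> D X \<xi> + dual_connection \<A> D X \<eta>"
  by (rule dual_connection_eqI)
    (use assms in \<open>simp_all add: subspace_add subspace_one_forms dual_connection_in act_add
      dual_connection_act lie_derivative_add pairing_smooth\<close>)

end

section \<open>Weak generalized almost complex structures\<close>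

lemma act_apply [simp]: "(A \<cdot> s) p = A p (s p)"
  by (simp add: act_def)

lemma of_TM_apply [simp]: "of_TM X p = (X p, 0)"
  and of_TsM_apply [simp]: "of_TsM \<xi> p = (0, \<xi> p)"
  and TM_part_apply [simp]: "TM_part s p = fst (s p)"
  and TsM_part_apply [simp]: "TsM_part s p = snd (s p)"
  by (simp_all add: of_TM_def of_TsM_def TM_part_def TsM_part_def)

lemma TM_part_of_TM [simp]: "TM_part (of_TM X) = X"
  and TM_part_of_TsM [simp]: "TM_part (of_TsM \<xi>) = 0"
  and TsM_part_of_TM [simp]: "TsM_part (of_TM X) = 0"
  and TsM_part_of_TsM [simp]: "TsM_part (of_TsM \<xi>) = \<xi>"
  by (rule ext, simp)+

lemma TM_part_add: "TM_part (s + t) = TM_part s + TM_part t"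
  and TsM_part_add: "TsM_part (s + t) = TsM_part s + TsM_part t"
  by (rule ext, simp)+

lemma gsection_decompose:
  fixes s :: "('a, 'b::euclidean_space) gsection"
  shows "s = of_TM (TM_part s) + of_TsM (TsM_part s)"
  by (rule ext) simp

lemma gsection_eqI: "TM_part s = TM_part t \<Longrightarrow> TsM_part s = TsM_part t \<Longrightarrow> s = t"
  by (simp add: fun_eq_iff prod_eq_iff)

locale gen_complex_connection = manifold_connection \<A> D
  for \<A> :: "('a::{t2_space, second_countable_topology}, 'b::euclidean_space) chart set"
    and D :: "('a, 'b) vfield \<Rightarrow> ('a, 'b) vfield \<Rightarrow> ('a, 'b) vfield" +
  fixes J :: "('a, 'b) gendo"
  assumes J: "weak_gen_almost_complex \<A> J"
begin

abbreviation "H \<equiv> block_H J"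
abbreviation "\<alpha> \<equiv> block_alpha J"
abbreviation "\<beta> \<equiv> block_beta J"
abbreviation "K \<equiv> block_K J"
abbreviation "D' \<equiv> dual_connection \<A> D"

section \<open>Fibrewise linearity of \<open>J\<close> and its action on smooth sections\<close>

lemma J_in: "u \<in> gen_tangent_space \<A> p \<Longrightarrow> J p u \<in> gen_tangent_space \<A> p"
  and J_add: "u \<in> gen_tangent_space \<A> p \<Longrightarrow> w \<in> gen_tangent_space \<A> p \<Longrightarrow> J p (u + w) = J p u + J p w"
  and J_scaleR: "u \<in> gen_tangent_space \<A> p \<Longrightarrow> J p (r *\<^sub>R u) = r *\<^sub>R J p u"
  and J_square: "u \<in> gen_tangent_space \<A> p \<Longrightarrow> J p (J p u) = - u"
  using J unfolding weak_gen_almost_complex_def smooth_bundle_endo_def by blast+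

lemma J_0 [simp]: "J p 0 = 0"
  using J_scaleR[OF subspace_0[OF subspace_gen_tangent_space], of p 0] by simp

lemma J_minus: "u \<in> gen_tangent_space \<A> p \<Longrightarrow> J p (- u) = - J p u"
  using J_scaleR[of u p "-1"] by simp

lemma J_sum:
  assumes "\<And>i. i \<in> I \<Longrightarrow> u i \<in> gen_tangent_space \<A> p"
  shows "J p (\<Sum>i\<in>I. r i *\<^sub>R u i) = (\<Sum>i\<in>I. r i *\<^sub>R J p (u i))"
  using assms
  by (induction I rule: infinite_finite_induct)
    (auto simp: J_add J_scaleR subspace_sum subspace_scale subspace_gen_tangent_space)

lemma gen_tangent_space_iff:
  "(v, \<omega>) \<in> gen_tangent_space \<A> p \<longleftrightarrow> v \<in> tangent_space \<A> p \<and> \<omega> \<in> cotangent_space \<A> p"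
  by (simp add: gen_tangent_space_def)

text \<open>Smoothness of \<open>J\<close> is given on the coordinate frame only; this expresses
  every other value by the frame, with the components of \<open>u\<close> as coefficients.\<close>

lemma J_expand:
  assumes u: "u \<in> gen_tangent_space \<A> p" and c: "c \<in> \<A>" "p \<in> dom_chart c"
  shows "J p u = (\<Sum>e\<in>Basis. (fst u c \<bullet> e) *\<^sub>R J p (coord_vector \<A> c e p, 0))
    + (\<Sum>e\<in>Basis. snd u (coord_vector \<A> c e p) *\<^sub>R J p (0, coord_covector \<A> c e p))"
proof -
  have u12: "fst u \<in> tangent_space \<A> p" "snd u \<in> cotangent_space \<A> p"
    using u by (auto simp: gen_tangent_space_def)
  have in1: "(coord_vector \<A> c e p, 0) \<in> gen_tangent_space \<A> p"
    and in2: "(0, coord_covector \<A> c e p) \<in> gen_tangent_space \<A> p" for e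
    using c by (simp_all add: gen_tangent_space_iff coord_vector_in_tangent_space
        coord_covector_in_cotangent_space subspace_0 subspace_tangent_space subspace_cotangent_space)
  have "u = (\<Sum>e\<in>Basis. (fst u c \<bullet> e) *\<^sub>R (coord_vector \<A> c e p, 0))
    + (\<Sum>e\<in>Basis. snd u (coord_vector \<A> c e p) *\<^sub>R (0, coord_covector \<A> c e p))" (is "u = ?u1 + ?u2")
  proof (rule prod_eqI)
    show "fst u = fst (?u1 + ?u2)"
      using tangent_vector_expand[OF u12(1) c] by (simp add: fst_sum)
    show "snd u = snd (?u1 + ?u2)"
      using covector_expand[OF u12(2) c] by (simp add: snd_sum)
  qed
  then have "J p u = J p (?u1 + ?u2)" by (rule arg_cong)
  also have "\<dots> = J p ?u1 + J p ?u2"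
    by (intro J_add subspace_sum subspace_scale subspace_gen_tangent_space in1 in2)
  finally show ?thesis by (simp only: J_sum[OF in1] J_sum[OF in2])
qed

lemma gen_sectionsD: "s \<in> gen_sections \<A> \<Longrightarrow> s p \<in> gen_tangent_space \<A> p"
  by (simp add: gen_sections_def gen_tangent_space_def mem_Times_iff
      vector_fieldsD[of "TM_part s", simplified] one_formsD[of "TsM_part s", simplified])

text \<open>Each component of \<open>J \<cdot> s\<close> is, by \<open>J_expand\<close>, a finite
  sum of components of \<open>s\<close> times matrix entries of \<open>J\<close>, both smooth in the
  chart.\<close>

lemma J_section:
  assumes s: "s \<in> gen_sections \<A>"
  shows "J \<cdot> s \<in> gen_sections \<A>"
proof -
  have X: "TM_part s \<in> vector_fields \<A>" and \<xi>: "TsM_part s \<in> one_forms \<A>"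
    using s by (auto simp: gen_sections_def)
  have in_space: "(J \<cdot> s) p \<in> gen_tangent_space \<A> p" for p
    by (simp add: J_in gen_sectionsD s)
  have frame: "smooth_on (cod_chart c) (\<lambda>x. fst (J (inv_chart c x) (coord_vector \<A> c e (inv_chart c x), 0)) c)"
      "smooth_on (cod_chart c) (\<lambda>x. fst (J (inv_chart c x) (0, coord_covector \<A> c e (inv_chart c x))) c)"
      "e' \<in> Basis \<Longrightarrow> smooth_on (cod_chart c) (\<lambda>x. snd (J (inv_chart c x) (coord_vector \<A> c e (inv_chart c x), 0))
          (coord_vector \<A> c e' (inv_chart c x)))"
      "e' \<in> Basis \<Longrightarrow> smooth_on (cod_chart c) (\<lambda>x. snd (J (inv_chart c x) (0, coord_covector \<A> c e (inv_chart c x)))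
          (coord_vector \<A> c e' (inv_chart c x)))"
    if c: "c \<in> \<A>" "e \<in> Basis" for c e e'
  proof -
    have "\<forall>s\<in>{of_TM (coord_vector \<A> c e), of_TsM (coord_covector \<A> c e)}.
        vector_smooth_in c (TM_part (J \<cdot> s)) \<and> covector_smooth_in \<A> c (TsM_part (J \<cdot> s))"
      using J c unfolding weak_gen_almost_complex_def smooth_bundle_endo_def by blast
    then show "smooth_on (cod_chart c) (\<lambda>x. fst (J (inv_chart c x) (coord_vector \<A> c e (inv_chart c x), 0)) c)"
      "smooth_on (cod_chart c) (\<lambda>x. fst (J (inv_chart c x) (0, coord_covector \<A> c e (inv_chart c x))) c)"
      "e' \<in> Basis \<Longrightarrow> smooth_on (cod_chart c) (\<lambda>x. snd (J (inv_chart c x) (coord_vector \<A> c e (inv_chart c x), 0))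
          (coord_vector \<A> c e' (inv_chart c x)))"
      "e' \<in> Basis \<Longrightarrow> smooth_on (cod_chart c) (\<lambda>x. snd (J (inv_chart c x) (0, coord_covector \<A> c e (inv_chart c x)))
          (coord_vector \<A> c e' (inv_chart c x)))"
      by (simp_all add: vector_smooth_in_def covector_smooth_in_def)
  qed
  have coeff: "smooth_on (cod_chart c) (\<lambda>x. fst (s (inv_chart c x)) c \<bullet> e)"
      "e \<in> Basis \<Longrightarrow> smooth_on (cod_chart c) (\<lambda>x. snd (s (inv_chart c x)) (coord_vector \<A> c e (inv_chart c x)))"
    if c: "c \<in> \<A>" for c e
    using smooth_on_inner_const[OF open_cod_chart[OF c] vector_field_smooth[OF X c]]
      one_form_smooth[OF \<xi> c] by simp_all
  have "TM_part (J \<cdot> s) \<in> vector_fields \<A>"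
    unfolding vector_fields_def mem_Collect_eq vector_smooth_in_def
  proof (intro conjI allI ballI)
    fix p show "TM_part (J \<cdot> s) p \<in> tangent_space \<A> p"
      using in_space[of p] by (simp add: gen_tangent_space_def mem_Times_iff)
  next
    fix c assume c: "c \<in> \<A>"
    have "smooth_on (cod_chart c) (\<lambda>x.
        (\<Sum>e\<in>Basis. (fst (s (inv_chart c x)) c \<bullet> e) *\<^sub>R fst (J (inv_chart c x) (coord_vector \<A> c e (inv_chart c x), 0)) c)
        + (\<Sum>e\<in>Basis. snd (s (inv_chart c x)) (coord_vector \<A> c e (inv_chart c x))
             *\<^sub>R fst (J (inv_chart c x) (0, coord_covector \<A> c e (inv_chart c x))) c))"
      by (intro smooth_on_add smooth_on_sum smooth_on_scaleR open_cod_chart c coeff frame)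
    then show "smooth_on (cod_chart c) (\<lambda>x. TM_part (J \<cdot> s) (inv_chart c x) c)"
      by (rule smooth_on_cong[OF open_cod_chart[OF c], rotated])
        (simp add: c J_expand[OF gen_sectionsD[OF s] c] fst_sum sum_fun_apply)
  qed
  moreover have "TsM_part (J \<cdot> s) \<in> one_forms \<A>"
    unfolding one_forms_def mem_Collect_eq covector_smooth_in_def
  proof (intro conjI allI ballI)
    fix p show "TsM_part (J \<cdot> s) p \<in> cotangent_space \<A> p"
      using in_space[of p] by (simp add: gen_tangent_space_def mem_Times_iff)
  next
    fix c and e' :: 'b assume c: "c \<in> \<A>" and e': "e' \<in> Basis"
    have "smooth_on (cod_chart c) (\<lambda>x.
        (\<Sum>e\<in>Basis. (fst (s (inv_chart c x)) c \<bullet> e) * snd (J (inv_chart c x) (coord_vector \<A> c e (inv_chart c x), 0))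
             (coord_vector \<A> c e' (inv_chart c x)))
        + (\<Sum>e\<in>Basis. snd (s (inv_chart c x)) (coord_vector \<A> c e (inv_chart c x))
             * snd (J (inv_chart c x) (0, coord_covector \<A> c e (inv_chart c x))) (coord_vector \<A> c e' (inv_chart c x))))"
      by (intro smooth_on_add smooth_on_sum smooth_on_mult open_cod_chart c coeff frame e')
    then show "smooth_on (cod_chart c) (\<lambda>x. TsM_part (J \<cdot> s) (inv_chart c x) (coord_vector \<A> c e' (inv_chart c x)))"
      by (rule smooth_on_cong[OF open_cod_chart[OF c], rotated])
        (simp add: c J_expand[OF gen_sectionsD[OF s] c] snd_sum sum_fun_apply)
  qed
  ultimately show ?thesis by (simp add: gen_sections_def)
qed

lemma zero_vector_field [simp]: "0 \<in> vector_fields \<A>"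
  and zero_one_form [simp]: "0 \<in> one_forms \<A>"
  by (simp_all add: subspace_0 subspace_vector_fields subspace_one_forms)

lemma of_TM_section [simp]: "of_TM X \<in> gen_sections \<A> \<longleftrightarrow> X \<in> vector_fields \<A>"
  and of_TsM_section [simp]: "of_TsM \<xi> \<in> gen_sections \<A> \<longleftrightarrow> \<xi> \<in> one_forms \<A>"
  by (simp_all add: gen_sections_def)

section \<open>The block form of \<open>J\<close>\<close>

lemma TM_part_J_of_TM: "TM_part (J \<cdot> of_TM X) = H \<cdot> X"
  and TsM_part_J_of_TM: "TsM_part (J \<cdot> of_TM X) = \<beta> \<cdot> X"
  and TM_part_J_of_TsM: "TM_part (J \<cdot> of_TsM \<xi>) = \<alpha> \<cdot> \<xi>"
  and TsM_part_J_of_TsM: "TsM_part (J \<cdot> of_TsM \<xi>) = K \<cdot> \<xi>"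
  by (rule ext, simp add: block_H_def block_alpha_def block_beta_def block_K_def)+

lemma block_fields [simp]:
  "X \<in> vector_fields \<A> \<Longrightarrow> H \<cdot> X \<in> vector_fields \<A>"
  "\<xi> \<in> one_forms \<A> \<Longrightarrow> \<alpha> \<cdot> \<xi> \<in> vector_fields \<A>"
  "X \<in> vector_fields \<A> \<Longrightarrow> \<beta> \<cdot> X \<in> one_forms \<A>"
  "\<xi> \<in> one_forms \<A> \<Longrightarrow> K \<cdot> \<xi> \<in> one_forms \<A>"
  using J_section[of "of_TM X"] J_section[of "of_TsM \<xi>"]
  by (simp_all add: gen_sections_def TM_part_J_of_TM TsM_part_J_of_TM TM_part_J_of_TsM TsM_part_J_of_TsM)

lemma gen_tangent_space_parts:
  "v \<in> tangent_space \<A> p \<Longrightarrow> (v, 0) \<in> gen_tangent_space \<A> p"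
  "\<omega> \<in> cotangent_space \<A> p \<Longrightarrow> (0, \<omega>) \<in> gen_tangent_space \<A> p"
  by (simp_all add: gen_tangent_space_iff subspace_0 subspace_tangent_space subspace_cotangent_space)

lemma block_in:
  "v \<in> tangent_space \<A> p \<Longrightarrow> H p v \<in> tangent_space \<A> p"
  "\<omega> \<in> cotangent_space \<A> p \<Longrightarrow> \<alpha> p \<omega> \<in> tangent_space \<A> p"
  "v \<in> tangent_space \<A> p \<Longrightarrow> \<beta> p v \<in> cotangent_space \<A> p"
  "\<omega> \<in> cotangent_space \<A> p \<Longrightarrow> K p \<omega> \<in> cotangent_space \<A> p"
  using J_in[OF gen_tangent_space_parts(1), of v p] J_in[OF gen_tangent_space_parts(2), of \<omega> p]
  by (auto simp: block_H_def block_alpha_def block_beta_def block_K_def gen_tangent_space_def mem_Times_iff)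

lemma J_block:
  assumes "v \<in> tangent_space \<A> p" "\<omega> \<in> cotangent_space \<A> p"
  shows "J p (v, \<omega>) = (H p v + \<alpha> p \<omega>, \<beta> p v + K p \<omega>)"
  using J_add[OF gen_tangent_space_parts, OF assms]
  by (simp add: prod_eq_iff block_H_def block_alpha_def block_beta_def block_K_def)

lemma block_add:
  "v \<in> tangent_space \<A> p \<Longrightarrow> w \<in> tangent_space \<A> p \<Longrightarrow> H p (v + w) = H p v + H p w"
  "v \<in> tangent_space \<A> p \<Longrightarrow> w \<in> tangent_space \<A> p \<Longrightarrow> \<beta> p (v + w) = \<beta> p v + \<beta> p w"
  "\<omega> \<in> cotangent_space \<A> p \<Longrightarrow> \<zeta> \<in> cotangent_space \<A> p \<Longrightarrow> \<alpha> p (\<omega> + \<zeta>) = \<alpha> p \<omega> + \<alpha> p \<zeta>"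
  "\<omega> \<in> cotangent_space \<A> p \<Longrightarrow> \<zeta> \<in> cotangent_space \<A> p \<Longrightarrow> K p (\<omega> + \<zeta>) = K p \<omega> + K p \<zeta>"
  using J_add[OF gen_tangent_space_parts(1,1), of v p w] J_add[OF gen_tangent_space_parts(2,2), of \<omega> p \<zeta>]
  by (simp_all add: block_H_def block_alpha_def block_beta_def block_K_def)

text \<open>Additivity applied to (v - w) + w.\<close>

lemma block_diff:
  "v \<in> tangent_space \<A> p \<Longrightarrow> w \<in> tangent_space \<A> p \<Longrightarrow> H p (v - w) = H p v - H p w"
  "v \<in> tangent_space \<A> p \<Longrightarrow> w \<in> tangent_space \<A> p \<Longrightarrow> \<beta> p (v - w) = \<beta> p v - \<beta> p w"
  "\<omega> \<in> cotangent_space \<A> p \<Longrightarrow> \<zeta> \<in> cotangent_space \<A> p \<Longrightarrow> \<alpha> p (\<omega> - \<zeta>) = \<alpha> p \<omega> - \<alpha> p \<zeta>"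
  "\<omega> \<in> cotangent_space \<A> p \<Longrightarrow> \<zeta> \<in> cotangent_space \<A> p \<Longrightarrow> K p (\<omega> - \<zeta>) = K p \<omega> - K p \<zeta>"
  using block_add(1,2)[of "v - w" p w] block_add(3,4)[of "\<omega> - \<zeta>" p \<zeta>]
    subspace_diff[OF subspace_tangent_space, of v p w] subspace_diff[OF subspace_cotangent_space, of \<omega> p \<zeta>]
  by (simp_all add: eq_diff_eq)

lemma block_zero: "H p 0 = 0" "\<beta> p 0 = 0" "\<alpha> p 0 = 0" "K p 0 = 0"
  using J_0[of p] by (simp_all add: block_H_def block_alpha_def block_beta_def block_K_def zero_prod_def)

lemma block_minus:
  "v \<in> tangent_space \<A> p \<Longrightarrow> H p (- v) = - H p v"
  "v \<in> tangent_space \<A> p \<Longrightarrow> \<beta> p (- v) = - \<beta> p v"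
  "\<omega> \<in> cotangent_space \<A> p \<Longrightarrow> \<alpha> p (- \<omega>) = - \<alpha> p \<omega>"
  "\<omega> \<in> cotangent_space \<A> p \<Longrightarrow> K p (- \<omega>) = - K p \<omega>"
  using J_minus[OF gen_tangent_space_parts(1), of v p] J_minus[OF gen_tangent_space_parts(2), of \<omega> p]
  by (simp_all add: block_H_def block_alpha_def block_beta_def block_K_def)

text \<open>The four entries of J^2 = -1. Each entry is a sum of two composites, one through TM and
  one through T*M; the rules are oriented to eliminate the one through T*M.\<close>

lemma block_square:
  "v \<in> tangent_space \<A> p \<Longrightarrow> \<alpha> p (\<beta> p v) = - v - H p (H p v)"
  "v \<in> tangent_space \<A> p \<Longrightarrow> K p (\<beta> p v) = - \<beta> p (H p v)"
  "\<omega> \<in> cotangent_space \<A> p \<Longrightarrow> \<alpha> p (K p \<omega>) = - H p (\<alpha> p \<omega>)"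
  "\<omega> \<in> cotangent_space \<A> p \<Longrightarrow> K p (K p \<omega>) = - \<omega> - \<beta> p (\<alpha> p \<omega>)"
proof -
  assume v: "v \<in> tangent_space \<A> p"
  have "J p (v, 0) = (H p v, \<beta> p v)" by (simp add: block_H_def block_beta_def)
  then have "J p (H p v, \<beta> p v) = - (v, 0)"
    using J_square[OF gen_tangent_space_parts(1)[OF v]] by simp
  then have eq: "H p (H p v) + \<alpha> p (\<beta> p v) = - v" "\<beta> p (H p v) + K p (\<beta> p v) = 0"
    using J_block[OF block_in(1)[OF v] block_in(3)[OF v]] by (simp_all add: uminus_prod_def)
  show "\<alpha> p (\<beta> p v) = - v - H p (H p v)" using eq(1) by (simp add: algebra_simps)
  show "K p (\<beta> p v) = - \<beta> p (H p v)" using eq(2) by (simp add: eq_neg_iff_add_eq_0 add.commute)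
next
  assume \<omega>: "\<omega> \<in> cotangent_space \<A> p"
  have "J p (0, \<omega>) = (\<alpha> p \<omega>, K p \<omega>)" by (simp add: block_alpha_def block_K_def)
  then have "J p (\<alpha> p \<omega>, K p \<omega>) = - (0, \<omega>)"
    using J_square[OF gen_tangent_space_parts(2)[OF \<omega>]] by simp
  then have eq: "H p (\<alpha> p \<omega>) + \<alpha> p (K p \<omega>) = 0" "\<beta> p (\<alpha> p \<omega>) + K p (K p \<omega>) = - \<omega>"
    using J_block[OF block_in(2)[OF \<omega>] block_in(4)[OF \<omega>]] by (simp_all add: uminus_prod_def)
  show "\<alpha> p (K p \<omega>) = - H p (\<alpha> p \<omega>)" using eq(1) by (simp add: eq_neg_iff_add_eq_0 add.commute)
  show "K p (K p \<omega>) = - \<omega> - \<beta> p (\<alpha> p \<omega>)" using eq(2) by (simp add: algebra_simps)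
qed

section \<open>The Nijenhuis tensor\<close>

lemma dual_connection_zero:
  "X \<in> vector_fields \<A> \<Longrightarrow> D' X 0 = 0"
  "\<xi> \<in> one_forms \<A> \<Longrightarrow> D' 0 \<xi> = 0"
  using dual_connection_add_right[of X 0 0] dual_connection_add_left[of 0 0 \<xi>] by simp_all

lemma lie_bracket_zero:
  "X \<in> vector_fields \<A> \<Longrightarrow> lie_bracket \<A> X 0 = 0"
  "X \<in> vector_fields \<A> \<Longrightarrow> lie_bracket \<A> 0 X = 0"
  using lie_bracket_add_right[of X 0 0] lie_bracket_add_left[of 0 0 X] by simp_all

lemma nabla_bracket_apply:
  "nabla_bracket \<A> D v w p = (lie_bracket \<A> (TM_part v) (TM_part w) p,
     D' (TM_part v) (TsM_part w) p - D' (TM_part w) (TsM_part v) p)"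
  by (simp add: nabla_bracket_def)

lemma nabla_bracket_in:
  assumes "v \<in> gen_sections \<A>" "w \<in> gen_sections \<A>"
  shows "nabla_bracket \<A> D v w p \<in> gen_tangent_space \<A> p"
  using assms
  by (simp add: nabla_bracket_apply gen_sections_def gen_tangent_space_iff
      lie_bracket_in_tangent_space subspace_diff[OF subspace_cotangent_space] one_formsD dual_connection_in)

lemma nijenhuis_apply:
  assumes "v \<in> gen_sections \<A>" "w \<in> gen_sections \<A>"
  shows "nijenhuis \<A> D J v w p = nabla_bracket \<A> D (J \<cdot> v) (J \<cdot> w) p
    - J p (nabla_bracket \<A> D (J \<cdot> v) w p) - J p (nabla_bracket \<A> D v (J \<cdot> w) p)
    - nabla_bracket \<A> D v w p"
  by (simp add: nijenhuis_def J_square[OF nabla_bracket_in[OF assms]])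

text \<open>Definitions and block rules, together with the memberships that discharge their side
  conditions. Torsion and covariant derivatives are unfolded too, so both sides of a component
  formula become expressions in brackets and connection terms, which cancel in an abelian
  group.\<close>

lemmas nijenhuis_simps = nijenhuis_apply nabla_bracket_apply TM_part_J_of_TM TsM_part_J_of_TM
  TM_part_J_of_TsM TsM_part_J_of_TsM hom_derivative_def torsion_def dual_connection_zero lie_bracket_zero
  J_block block_zero block_minus block_add block_diff block_square block_in lie_bracket_in_tangent_space
  vector_fieldsD one_formsD connection_in dual_connection_in
  subspace_diff[OF subspace_tangent_space] subspace_diff[OF subspace_cotangent_space]
  subspace_add[OF subspace_tangent_space] subspace_add[OF subspace_cotangent_space]
  subspace_neg[OF subspace_tangent_space] subspace_neg[OF subspace_cotangent_space]
  subspace_0[OF subspace_tangent_space] subspace_0[OF subspace_cotangent_space]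

text \<open>The last term of \<open>N\<close> is -[X, Y], because J^2 = -1; substituting [X, Y] =
  \<nabla>_X Y - \<nabla>_Y X - T(X, Y) makes T(X, Y) appear with a plus sign. The remaining
  connection terms cancel by \<alpha> \<beta> = -1 - H^2.\<close>

lemma nijenhuis_TM_TM_vector:
  assumes "X \<in> vector_fields \<A>" "Y \<in> vector_fields \<A>"
  shows "TM_part (nijenhuis \<A> D J (of_TM X) (of_TM Y)) =
    hom_derivative D D H (H \<cdot> X) Y - hom_derivative D D H (H \<cdot> Y) X
    - H \<cdot> (hom_derivative D D H X Y - hom_derivative D D H Y X)
    - \<alpha> \<cdot> (hom_derivative D D' \<beta> X Y - hom_derivative D D' \<beta> Y X)
    - torsion \<A> D (H \<cdot> X) (H \<cdot> Y) + torsion \<A> D X Y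
    + H \<cdot> (torsion \<A> D (H \<cdot> X) Y + torsion \<A> D X (H \<cdot> Y))"
  by (rule ext) (simp add: nijenhuis_simps assms algebra_simps)

text \<open>The brackets enter through -\<beta>[HX, Y] - \<beta>[X, HY], which gives the derivatives
  of H the coefficient -\<beta> and the torsion the coefficient +\<beta>. The leftover terms \<beta>
  H \<nabla>_X Y and \<beta> H \<nabla>_Y X cancel by K \<beta> = -\<beta> H.\<close>

lemma nijenhuis_TM_TM_covector:
  assumes "X \<in> vector_fields \<A>" "Y \<in> vector_fields \<A>"
  shows "TsM_part (nijenhuis \<A> D J (of_TM X) (of_TM Y)) =
    hom_derivative D D' \<beta> (H \<cdot> X) Y - hom_derivative D D' \<beta> (H \<cdot> Y) X
    - \<beta> \<cdot> (hom_derivative D D H X Y - hom_derivative D D H Y X)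
    - K \<cdot> (hom_derivative D D' \<beta> X Y - hom_derivative D D' \<beta> Y X)
    + \<beta> \<cdot> (torsion \<A> D (H \<cdot> X) Y + torsion \<A> D X (H \<cdot> Y))"
  by (rule ext) (simp add: nijenhuis_simps assms algebra_simps)

text \<open>Two one-forms have bracket 0, and the bracket of J \<xi> with \<eta> is
  \<nabla>_{\<alpha> \<xi>} \<eta>. Only [\<alpha> \<xi>, \<alpha> \<eta>] contributes
  torsion.\<close>

lemma nijenhuis_TsM_TsM_vector:
  assumes "\<xi> \<in> one_forms \<A>" "\<eta> \<in> one_forms \<A>"
  shows "TM_part (nijenhuis \<A> D J (of_TsM \<xi>) (of_TsM \<eta>)) =
    hom_derivative D' D \<alpha> (\<alpha> \<cdot> \<xi>) \<eta> - hom_derivative D' D \<alpha> (\<alpha> \<cdot> \<eta>) \<xi>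
    - torsion \<A> D (\<alpha> \<cdot> \<xi>) (\<alpha> \<cdot> \<eta>)"
  by (rule ext) (simp add: nijenhuis_simps assms algebra_simps)

lemma nijenhuis_TsM_TsM_covector:
  assumes "\<xi> \<in> one_forms \<A>" "\<eta> \<in> one_forms \<A>"
  shows "TsM_part (nijenhuis \<A> D J (of_TsM \<xi>) (of_TsM \<eta>)) =
    hom_derivative D' D' K (\<alpha> \<cdot> \<xi>) \<eta> - hom_derivative D' D' K (\<alpha> \<cdot> \<eta>) \<xi>"
  by (rule ext) (simp add: nijenhuis_simps assms algebra_simps)

text \<open>The terms with \<nabla>_X \<eta> cancel by \<alpha> K = -H \<alpha>.\<close>

lemma nijenhuis_TM_TsM_vector:
  assumes "X \<in> vector_fields \<A>" "\<eta> \<in> one_forms \<A>"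
  shows "TM_part (nijenhuis \<A> D J (of_TM X) (of_TsM \<eta>)) =
    hom_derivative D' D \<alpha> (H \<cdot> X) \<eta> - hom_derivative D D H (\<alpha> \<cdot> \<eta>) X
    - H \<cdot> hom_derivative D' D \<alpha> X \<eta> - \<alpha> \<cdot> hom_derivative D' D' K X \<eta>
    - torsion \<A> D (H \<cdot> X) (\<alpha> \<cdot> \<eta>) + H \<cdot> torsion \<A> D X (\<alpha> \<cdot> \<eta>)"
  by (rule ext) (simp add: nijenhuis_simps assms algebra_simps)

text \<open>Here J^2 [X, \<eta>] = -\<nabla>_X \<eta> survives and is absorbed by K^2 = -1 - \<beta>
  \<alpha>.\<close>

lemma nijenhuis_TM_TsM_covector:
  assumes "X \<in> vector_fields \<A>" "\<eta> \<in> one_forms \<A>"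
  shows "TsM_part (nijenhuis \<A> D J (of_TM X) (of_TsM \<eta>)) =
    hom_derivative D' D' K (H \<cdot> X) \<eta> - hom_derivative D D' \<beta> (\<alpha> \<cdot> \<eta>) X
    - \<beta> \<cdot> hom_derivative D' D \<alpha> X \<eta> - K \<cdot> hom_derivative D' D' K X \<eta>
    + \<beta> \<cdot> torsion \<A> D X (\<alpha> \<cdot> \<eta>)"
  by (rule ext) (simp add: nijenhuis_simps assms algebra_simps)

section \<open>Skew-symmetry and biadditivity of the Nijenhuis tensor\<close>

lemma nabla_bracket_antisym: "nabla_bracket \<A> D v w p = - nabla_bracket \<A> D w v p"
  using lie_bracket_antisym[of "TM_part v" "TM_part w"] by (simp add: nabla_bracket_apply)

lemma nijenhuis_antisym:
  assumes v: "v \<in> gen_sections \<A>" and w: "w \<in> gen_sections \<A>"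
  shows "nijenhuis \<A> D J v w = - nijenhuis \<A> D J w v"
proof
  fix p
  have "J p (nabla_bracket \<A> D (J \<cdot> v) w p) = - J p (nabla_bracket \<A> D w (J \<cdot> v) p)"
    "J p (nabla_bracket \<A> D v (J \<cdot> w) p) = - J p (nabla_bracket \<A> D (J \<cdot> w) v p)"
    using nabla_bracket_antisym[of "J \<cdot> v" w p] nabla_bracket_antisym[of v "J \<cdot> w" p]
    by (simp_all add: J_minus nabla_bracket_in v w J_section)
  then show "nijenhuis \<A> D J v w p = (- nijenhuis \<A> D J w v) p"
    using nabla_bracket_antisym[of v w p] nabla_bracket_antisym[of "J \<cdot> v" "J \<cdot> w" p]
    by (simp add: nijenhuis_apply v w)
qed

lemma gen_sections_add: "v \<in> gen_sections \<A> \<Longrightarrow> w \<in> gen_sections \<A> \<Longrightarrow> v + w \<in> gen_sections \<A>"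
  by (simp add: gen_sections_def TM_part_add TsM_part_add subspace_add subspace_vector_fields
      subspace_one_forms)

lemma nabla_bracket_add_left:
  assumes "v \<in> gen_sections \<A>" "v' \<in> gen_sections \<A>" "w \<in> gen_sections \<A>"
  shows "nabla_bracket \<A> D (v + v') w p = nabla_bracket \<A> D v w p + nabla_bracket \<A> D v' w p"
  using assms
  by (simp add: nabla_bracket_apply gen_sections_def TM_part_add TsM_part_add lie_bracket_add_left
      dual_connection_add_left dual_connection_add_right)

lemma nijenhuis_add_left:
  assumes v: "v \<in> gen_sections \<A>" "v' \<in> gen_sections \<A>" and w: "w \<in> gen_sections \<A>"
  shows "nijenhuis \<A> D J (v + v') w = nijenhuis \<A> D J v w + nijenhuis \<A> D J v' w"
proof
  fix p
  have "J \<cdot> (v + v') = J \<cdot> v + J \<cdot> v'"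
    by (rule ext) (simp add: J_add gen_sectionsD v)
  then show "nijenhuis \<A> D J (v + v') w p = (nijenhuis \<A> D J v w + nijenhuis \<A> D J v' w) p"
    by (simp add: nijenhuis_apply nabla_bracket_add_left gen_sections_add J_section v w J_add
        nabla_bracket_in algebra_simps)
qed

lemma nijenhuis_add_right:
  assumes "v \<in> gen_sections \<A>" "w \<in> gen_sections \<A>" "w' \<in> gen_sections \<A>"
  shows "nijenhuis \<A> D J v (w + w') = nijenhuis \<A> D J v w + nijenhuis \<A> D J v w'"
  using assms nijenhuis_antisym[of v] nijenhuis_add_left[of w w' v] by (simp add: gen_sections_add)

lemma nabla_integrable_iff:
  "nabla_integrable \<A> D J \<longleftrightarrow>
    (\<forall>X\<in>vector_fields \<A>. \<forall>Y\<in>vector_fields \<A>. \<forall>\<xi>\<in>one_forms \<A>. \<forall>\<eta>\<in>one_forms \<A>.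
      TM_part (nijenhuis \<A> D J (of_TM X) (of_TM Y)) = 0 \<and>
      TsM_part (nijenhuis \<A> D J (of_TM X) (of_TM Y)) = 0 \<and>
      TM_part (nijenhuis \<A> D J (of_TsM \<xi>) (of_TsM \<eta>)) = 0 \<and>
      TsM_part (nijenhuis \<A> D J (of_TsM \<xi>) (of_TsM \<eta>)) = 0 \<and>
      TM_part (nijenhuis \<A> D J (of_TM X) (of_TsM \<eta>)) = 0 \<and>
      TsM_part (nijenhuis \<A> D J (of_TM X) (of_TsM \<eta>)) = 0)" (is "?L \<longleftrightarrow> ?R")
proof
  have parts: "TM_part (0 :: ('a, 'b) gsection) = 0" "TsM_part (0 :: ('a, 'b) gsection) = 0"
    by (rule ext, simp)+
  {
    assume ?L
    then have N: "nijenhuis \<A> D J v w = 0" if "v \<in> gen_sections \<A>" "w \<in> gen_sections \<A>" for v w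
      using that by (simp add: nabla_integrable_def)
    show ?R by (simp add: N parts)
  next
    assume R: ?R
    have N: "nijenhuis \<A> D J (of_TM X) (of_TM Y) = 0" "nijenhuis \<A> D J (of_TsM \<xi>) (of_TsM \<eta>) = 0"
      "nijenhuis \<A> D J (of_TM X) (of_TsM \<eta>) = 0" "nijenhuis \<A> D J (of_TsM \<eta>) (of_TM X) = 0"
      if "X \<in> vector_fields \<A>" "Y \<in> vector_fields \<A>" "\<xi> \<in> one_forms \<A>" "\<eta> \<in> one_forms \<A>" for X Y \<xi> \<eta>
    proof -
      show "nijenhuis \<A> D J (of_TM X) (of_TM Y) = 0" "nijenhuis \<A> D J (of_TsM \<xi>) (of_TsM \<eta>) = 0"
        by (rule gsection_eqI; use R that in \<open>simp add: parts\<close>)+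
      show *: "nijenhuis \<A> D J (of_TM X) (of_TsM \<eta>) = 0"
        by (rule gsection_eqI; use R that in \<open>simp add: parts\<close>)
      show "nijenhuis \<A> D J (of_TsM \<eta>) (of_TM X) = 0"
        using nijenhuis_antisym[of "of_TsM \<eta>" "of_TM X"] * that by simp
    qed
    show ?L
      unfolding nabla_integrable_def
    proof (intro ballI)
      fix v w assume vw: "v \<in> gen_sections \<A>" "w \<in> gen_sections \<A>"
      then have p: "TM_part v \<in> vector_fields \<A>" "TM_part w \<in> vector_fields \<A>"
        "TsM_part v \<in> one_forms \<A>" "TsM_part w \<in> one_forms \<A>"
        by (simp_all add: gen_sections_def)
      have "nijenhuis \<A> D J v w = nijenhuis \<A> D J (of_TM (TM_part v) + of_TsM (TsM_part v))
          (of_TM (TM_part w) + of_TsM (TsM_part w))"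
        by (simp flip: gsection_decompose)
      also have "\<dots> = 0"
        \<comment> \<open>Biadditivity leaves four terms. \<open>N[OF p]\<close> settles all but the
          mixed one with the one-form of \<open>v\<close> in front; for that one the roles of
          \<open>v\<close> and \<open>w\<close> are exchanged.\<close>
        using p by (simp add: nijenhuis_add_left nijenhuis_add_right gen_sections_add N[OF p]
            N[OF p(2,1,4,3)])
      finally show "nijenhuis \<A> D J v w = 0" .
    qed
  }
qed

end

text \<open>Two signs differ from the formulas of the English statement: \<open>T X Y\<close> enters
  \<open>N1\<close> with plus, and \<open>\<beta> \<cdot> (DH X Y - DH Y X)\<close> enters
  \<open>N2\<close> with minus. These are the signs that J^2 = -1 and the definition of torsion
  produce. The component formulas are asserted for every \<open>J\<close> of the given kind, and
  integrability is their simultaneous vanishing.\<close>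

theorem proposition3p0p1:
  fixes \<A> :: "('a::{t2_space, second_countable_topology}, 'b::euclidean_space) chart set"
    and D :: "('a, 'b) vfield \<Rightarrow> ('a, 'b) vfield \<Rightarrow> ('a, 'b) vfield"
    and J :: "('a, 'b) gendo"
  assumes "smooth_atlas \<A>"
    and "affine_connection \<A> D"
    and "weak_gen_almost_complex \<A> J"
  shows "let
      H = block_H J; \<alpha> = block_alpha J; \<beta> = block_beta J; K = block_K J;
      D' = dual_connection \<A> D;
      DH = hom_derivative D D H;
      D\<alpha> = hom_derivative D' D \<alpha>;
      D\<beta> = hom_derivative D D' \<beta>;
      DK = hom_derivative D' D' K;
      T = torsion \<A> D;
      N = nijenhuis \<A> D J;
      N1 = (\<lambda>X Y. DH (H \<cdot> X) Y - DH (H \<cdot> Y) X - H \<cdot> (DH X Y - DH Y X)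
              - \<alpha> \<cdot> (D\<beta> X Y - D\<beta> Y X)
              - T (H \<cdot> X) (H \<cdot> Y) + T X Y + H \<cdot> (T (H \<cdot> X) Y + T X (H \<cdot> Y)));
      N2 = (\<lambda>X Y. D\<beta> (H \<cdot> X) Y - D\<beta> (H \<cdot> Y) X - \<beta> \<cdot> (DH X Y - DH Y X)
              - K \<cdot> (D\<beta> X Y - D\<beta> Y X)
              + \<beta> \<cdot> (T (H \<cdot> X) Y + T X (H \<cdot> Y)));
      N3 = (\<lambda>\<xi> \<eta>. D\<alpha> (\<alpha> \<cdot> \<xi>) \<eta> - D\<alpha> (\<alpha> \<cdot> \<eta>) \<xi> - T (\<alpha> \<cdot> \<xi>) (\<alpha> \<cdot> \<eta>));
      N4 = (\<lambda>\<xi> \<eta>. DK (\<alpha> \<cdot> \<xi>) \<eta> - DK (\<alpha> \<cdot> \<eta>) \<xi>);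
      N5 = (\<lambda>X \<eta>. D\<alpha> (H \<cdot> X) \<eta> - DH (\<alpha> \<cdot> \<eta>) X - H \<cdot> D\<alpha> X \<eta> - \<alpha> \<cdot> DK X \<eta>
              - T (H \<cdot> X) (\<alpha> \<cdot> \<eta>) + H \<cdot> T X (\<alpha> \<cdot> \<eta>));
      N6 = (\<lambda>X \<eta>. DK (H \<cdot> X) \<eta> - D\<beta> (\<alpha> \<cdot> \<eta>) X - \<beta> \<cdot> D\<alpha> X \<eta> - K \<cdot> DK X \<eta>
              + \<beta> \<cdot> T X (\<alpha> \<cdot> \<eta>))
    in
      (\<forall>X\<in>vector_fields \<A>. \<forall>Y\<in>vector_fields \<A>. \<forall>\<xi>\<in>one_forms \<A>. \<forall>\<eta>\<in>one_forms \<A>.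
         TM_part (N (of_TM X) (of_TM Y)) = N1 X Y \<and>
         TsM_part (N (of_TM X) (of_TM Y)) = N2 X Y \<and>
         TM_part (N (of_TsM \<xi>) (of_TsM \<eta>)) = N3 \<xi> \<eta> \<and>
         TsM_part (N (of_TsM \<xi>) (of_TsM \<eta>)) = N4 \<xi> \<eta> \<and>
         TM_part (N (of_TM X) (of_TsM \<eta>)) = N5 X \<eta> \<and>
         TsM_part (N (of_TM X) (of_TsM \<eta>)) = N6 X \<eta>) \<and>
      (nabla_integrable \<A> D J \<longleftrightarrow>
        (\<forall>X\<in>vector_fields \<A>. \<forall>Y\<in>vector_fields \<A>. \<forall>\<xi>\<in>one_forms \<A>. \<forall>\<eta>\<in>one_forms \<A>.
           N1 X Y = 0 \<and> N2 X Y = 0 \<and> N3 \<xi> \<eta> = 0 \<and> N4 \<xi> \<eta> = 0 \<and> N5 X \<eta> = 0 \<and> N6 X \<eta> = 0))"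
proof -
  interpret gen_complex_connection \<A> D J
    by unfold_locales (rule assms)+
  note N = nijenhuis_TM_TM_vector nijenhuis_TM_TM_covector nijenhuis_TsM_TsM_vector
    nijenhuis_TsM_TsM_covector nijenhuis_TM_TsM_vector nijenhuis_TM_TsM_covector
  show ?thesis
    unfolding Let_def
    \<comment> \<open>The component formulas are the rules \<open>N\<close> themselves. In the
      equivalence they are rewrite rules, and \<open>ball_cong\<close> provides the memberships that
      they require.\<close>
    by (intro conjI ballI N; (assumption | (unfold nabla_integrable_iff, intro ball_cong refl, simp only: N)))
qed

end
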